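(* There are positive constants $K,\alpha,\kappa,\delta_0,A,c_1,c_2,c_3$ such that for $N\in\mathbb{N}$, time $T=A\log(N)$, any $\delta<\delta_0$, and $\xi\in\mathbb{N}^N$, the Fleming-Viot process with $N$ walks satisfies $$ \begin{aligned} E\left[\exp\big(\delta\max(\xi_T)\big)\,\middle|\,\xi_0=\xi\right]-\exp\big(\delta\max(\xi)\big) <\;& -c_1\,\mathbf{1}_{\{\max(\xi)>K\log(N)\}}\,e^{\delta\max(\xi)}\\ &+c_2\,\mathbf{1}_{\{\max(\xi)>K\log(N)\}}\,e^{-\kappa T}e^{\delta\max(\xi)}+c_3\,e^{\delta\alpha\log(N)} . \end{aligned} $$ As a consequence, for $N$ large enough there is a unique invariant measure $\lambda_N$ for the Fleming-Viot process with $N$ walks. Integrating over $\lambda_N$, there are $\beta,C>0$ such that for any $N$, and $\delta<\delta_0$, $$ \int \exp\big(\delta\max(\xi)\big)\,d\lambda_N(\xi)\;\le\; C\exp\big(\delta\beta\log(N)\big). $$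
   Context: $\mathbb{N}$ is the set of positive integers. Let $p,q>0$ with $q=1-p>p$. The Fleming-Viot process with $N$ walks is the continuous-time Markov process $\xi_t=(\xi_1(t),\dots,\xi_N(t))\in\mathbb{N}^N$ in which the coordinates (walks) perform independent continuous-time nearest neighbor random walks, jumping by $+1$ at rate $p$ and by $-1$ at rate $q$ (so the drift is $-v$ with $v=q-p>0$), except that when a walk reaches the origin $0$ it instantly jumps to the current position of one of the other $N-1$ walks, chosen uniformly at random. For $\xi\in\mathbb{N}^N$, $\max(\xi)=\max_{1\le i\le N}\xi_i$ is the rightmost position. $E[\cdot\,|\,\xi_0=\xi]$ denotes the average with respect to the law of the process with initial condition $\xi$, and $\mathbf{1}$ denotes an indicator.
   Formalization: Proved for N ≥ 2 and 0 ≤ δ < δ₀, with c₁ allowed to depend on δ (not on N or ξ): with c₁ uniform in δ the first inequality fails as δ → 0, N → ∞, and for very negative δ both bounds fail. *)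

theory Defs
  imports "HOL-Probability.Probability" "HOL-Real_Asymp.Real_Asymp"
begin

section \<open>Continuous-time Markov processes given by their jump rates\<close>

text \<open>
  A time-homogeneous Markov process on a countable state space \<open>S\<close> is described by its transition
  function: \<open>P t x\<close> is the law at time \<open>t\<close> of the process started from \<open>x\<close>. It is a process with
  jump rates \<open>R x y\<close> (\<open>x \<noteq> y\<close>) if \<open>P h x y = R x y * h + o(h)\<close> for \<open>y \<noteq> x\<close> and the process is
  conservative, i.e. \<open>P h x x = 1 - h * (total rate of leaving x) + o(h)\<close>. The values of \<open>P\<close> at
  negative times and outside \<open>S\<close> and the diagonal values \<open>R x x\<close> are irrelevant.
\<close>

definition transition_function ::
    "'s set \<Rightarrow> ('s \<Rightarrow> 's \<Rightarrow> real) \<Rightarrow> (real \<Rightarrow> 's \<Rightarrow> 's pmf) \<Rightarrow> bool" where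
  "transition_function S R P \<longleftrightarrow>
     (\<forall>t\<ge>0. \<forall>x\<in>S. set_pmf (P t x) \<subseteq> S) \<and>
     (\<forall>x\<in>S. P 0 x = return_pmf x) \<and>
     (\<forall>s\<ge>0. \<forall>t\<ge>0. \<forall>x\<in>S. P (s + t) x = bind_pmf (P s x) (P t)) \<and>
     (\<forall>x\<in>S. \<forall>y\<in>S. y \<noteq> x \<longrightarrow> ((\<lambda>h. pmf (P h x) y / h) \<longlongrightarrow> R x y) (at_right 0)) \<and>
     (\<forall>x\<in>S. ((\<lambda>h. (1 - pmf (P h x) x) / h) \<longlongrightarrow> (\<Sum>\<^sub>\<infinity>y\<in>S - {x}. R x y)) (at_right 0))"

section \<open>The Fleming-Viot process\<close>

text \<open>
  A configuration of \<open>N\<close> walks on the positive integers is a list of length \<open>N\<close>; the walks are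
  numbered \<open>0, \<dots>, N - 1\<close>.
\<close>

definition configs :: "nat \<Rightarrow> nat list set" where
  "configs N = {\<xi>. length \<xi> = N \<and> (\<forall>x\<in>set \<xi>. 1 \<le> x)}"

definition rightmost :: "nat list \<Rightarrow> nat" where
  "rightmost \<xi> = Max (set \<xi>)"

text \<open>
  Each walk \<open>i\<close> moves by \<open>+1\<close> at rate \<open>p\<close> and by \<open>-1\<close> at rate \<open>q\<close>. A walk at site 1 that would move
  to the origin is instantly put at the position of another walk \<open>j\<close>, so each of the \<open>N - 1\<close> choices
  of \<open>j\<close> has rate \<open>q / (N - 1)\<close>. Different moves may lead to the same configuration, whence the sums.
\<close>

definition fv_rate :: "real \<Rightarrow> real \<Rightarrow> nat \<Rightarrow> nat list \<Rightarrow> nat list \<Rightarrow> real" where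
  "fv_rate p q N \<xi> \<eta> =
     (\<Sum>i<N. p * of_bool (\<eta> = \<xi>[i := \<xi> ! i + 1])
           + (if \<xi> ! i = 1
              then \<Sum>j\<in>{..<N} - {i}. q / (real N - 1) * of_bool (\<eta> = \<xi>[i := \<xi> ! j])
              else q * of_bool (\<eta> = \<xi>[i := \<xi> ! i - 1])))"

text \<open>
  \<open>fleming_viot p q N t \<xi>\<close> is the law of \<open>\<xi>\<^sub>t\<close> for the Fleming-Viot process with \<open>N\<close> walks and initial
  condition \<open>\<xi>\<close>. For \<open>N \<ge> 2\<close>, \<open>p, q > 0\<close> and \<open>p + q = 1\<close> a transition function with the rates above
  exists and is unique, see \<open>transition_function_fleming_viot\<close> and \<open>fleming_viot_unique\<close> below.
\<close>

definition fleming_viot :: "real \<Rightarrow> real \<Rightarrow> nat \<Rightarrow> real \<Rightarrow> nat list \<Rightarrow> nat list pmf" where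
  "fleming_viot p q N = (SOME P. transition_function (configs N) (fv_rate p q N) P)"

definition fv_invariant :: "real \<Rightarrow> real \<Rightarrow> nat \<Rightarrow> nat list pmf \<Rightarrow> bool" where
  "fv_invariant p q N \<mu> \<longleftrightarrow>
     set_pmf \<mu> \<subseteq> configs N \<and> (\<forall>t\<ge>0. bind_pmf \<mu> (fleming_viot p q N t) = \<mu>)"

section \<open>Existence and uniqueness for uniformizable rates\<close>

primrec kernel_power :: "('s \<Rightarrow> 's pmf) \<Rightarrow> nat \<Rightarrow> 's \<Rightarrow> 's pmf" where
  "kernel_power K 0 x = return_pmf x"
| "kernel_power K (Suc n) x = bind_pmf (K x) (kernel_power K n)"

lemma kernel_power_add:
  "kernel_power K (m + n) x = bind_pmf (kernel_power K m x) (kernel_power K n)"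
proof (induction m arbitrary: x)
  case (Suc m)
  then have "kernel_power K (m + n) = (\<lambda>y. bind_pmf (kernel_power K m y) (kernel_power K n))"
    by blast
  then show ?case
    by (simp add: bind_assoc_pmf)
qed (simp add: bind_return_pmf)

lemma poisson_add:
  fixes a b :: real
  assumes "a > 0" "b > 0"
  shows "bind_pmf (poisson_pmf a) (\<lambda>m. map_pmf ((+) m) (poisson_pmf b)) = poisson_pmf (a + b)"
proof (rule pmf_eqI)
  fix k :: nat
  have shift: "pmf (map_pmf ((+) m) (poisson_pmf b)) k =
      (if m \<le> k then b ^ (k - m) / fact (k - m) * exp (- b) else 0)" for m
  proof (cases "m \<le> k")
    case True
    have "pmf (map_pmf ((+) m) (poisson_pmf b)) (m + (k - m)) = pmf (poisson_pmf b) (k - m)"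
      by (rule pmf_map_inj') (auto simp: inj_def)
    then show ?thesis
      using True assms by simp
  next
    case False
    then show ?thesis
      by (auto intro!: pmf_map_outside)
  qed
  have "pmf (bind_pmf (poisson_pmf a) (\<lambda>m. map_pmf ((+) m) (poisson_pmf b))) k =
      (\<integral>m. (if m \<le> k then b ^ (k - m) / fact (k - m) * exp (- b) else 0) \<partial>poisson_pmf a)"
    unfolding pmf_bind shift ..
  also have "\<dots> = (\<Sum>m\<le>k. (if m \<le> k then b ^ (k - m) / fact (k - m) * exp (- b) else 0)
      * pmf (poisson_pmf a) m)"
    by (subst integral_measure_pmf_real[where A = "{..k}"]) (auto split: if_splits)
  also have "\<dots> = (\<Sum>m\<le>k. of_nat (k choose m) * a ^ m * b ^ (k - m)) * (exp (- a - b) / fact k)"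
    unfolding sum_distrib_right
  proof (rule sum.cong)
    fix m assume "m \<in> {..k}"
    moreover have "exp (- a - b) = exp (- a) * exp (- b)"
      by (simp flip: exp_add)
    ultimately show "(if m \<le> k then b ^ (k - m) / fact (k - m) * exp (- b) else 0)
        * pmf (poisson_pmf a) m =
        of_nat (k choose m) * a ^ m * b ^ (k - m) * (exp (- a - b) / fact k)"
      using assms by (simp add: binomial_fact field_simps)
  qed simp
  also have "\<dots> = pmf (poisson_pmf (a + b)) k"
    using assms by (simp add: binomial_ring)
  finally show "pmf (bind_pmf (poisson_pmf a) (\<lambda>m. map_pmf ((+) m) (poisson_pmf b))) k =
      pmf (poisson_pmf (a + b)) k" .
qed

lemma expectation_finite_part:
  fixes g :: "'s \<Rightarrow> real"
  assumes "finite G" and g: "\<And>z. 0 \<le> g z" "\<And>z. g z \<le> 1"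
  shows "\<bar>measure_pmf.expectation M g - (\<Sum>z\<in>G. pmf M z * g z)\<bar> \<le> 1 - (\<Sum>z\<in>G. pmf M z)"
proof -
  have int: "integrable M g" "integrable M (\<lambda>z. g z * indicator G z)"
    "integrable M (\<lambda>z. g z * indicator (- G) z)"
    using g by (auto intro!: measure_pmf.integrable_const_bound[of _ 1] AE_pmfI
        simp: indicator_def abs_le_iff order_trans[OF _ g(1)])
  have "measure_pmf.expectation M (\<lambda>z. g z * indicator G z) = (\<Sum>z\<in>G. pmf M z * g z)"
    using assms(1) by (subst integral_measure_pmf_real[where A = G])
      (auto simp: indicator_def mult.commute split: if_splits intro!: sum.cong)
  moreover have "measure_pmf.expectation M g = measure_pmf.expectation M (\<lambda>z. g z * indicator G z)
      + measure_pmf.expectation M (\<lambda>z. g z * indicator (- G) z)"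
  proof -
    have "g z = g z * indicator G z + g z * indicator (- G) z" for z
      by (simp add: indicator_def)
    then have "measure_pmf.expectation M g =
        measure_pmf.expectation M (\<lambda>z. g z * indicator G z + g z * indicator (- G) z)"
      by presburger
    then show ?thesis
      using int by simp
  qed
  moreover have "measure_pmf.expectation M (\<lambda>z. g z * indicator (- G) z) \<ge> 0"
    using g by (intro integral_nonneg_AE AE_pmfI) (auto simp: indicator_def)
  moreover have "measure_pmf.expectation M (\<lambda>z. g z * indicator (- G) z)
      \<le> measure_pmf.expectation M (indicator (- G))"
    using int g by (intro integral_mono)
      (auto simp: indicator_def intro!: measure_pmf.integrable_const_bound[of _ 1] AE_pmfI)
  moreover have "measure_pmf.expectation M (indicator (- G)) = 1 - (\<Sum>z\<in>G. pmf M z)"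
    using measure_pmf.prob_compl[of G M] assms(1)
    by (simp add: Compl_eq_Diff_UNIV measure_measure_pmf_finite)
  ultimately show ?thesis
    by simp
qed

locale uniformizable =
  fixes S :: "'s set" and R :: "'s \<Rightarrow> 's \<Rightarrow> real" and c :: real and K :: "'s \<Rightarrow> 's pmf"
  assumes c_pos: "c > 0"
    and K_closed: "x \<in> S \<Longrightarrow> set_pmf (K x) \<subseteq> S"
    and K_finite: "x \<in> S \<Longrightarrow> finite (set_pmf (K x))"
    and R_eq: "x \<in> S \<Longrightarrow> y \<in> S \<Longrightarrow> y \<noteq> x \<Longrightarrow> R x y = c * pmf (K x) y"
begin

lemma exit_rate:
  assumes x: "x \<in> S"
  shows "(\<Sum>\<^sub>\<infinity>y\<in>S - {x}. R x y) = c * (1 - pmf (K x) x)"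
proof -
  have "(\<Sum>\<^sub>\<infinity>y\<in>S - {x}. R x y) = (\<Sum>\<^sub>\<infinity>y\<in>set_pmf (K x) - {x}. c * pmf (K x) y)"
    using x K_closed[OF x] R_eq[OF x] by (intro infsum_cong_neutral) (auto simp: set_pmf_iff)
  also have "\<dots> = (\<Sum>y\<in>set_pmf (K x) - {x}. c * pmf (K x) y)"
    using K_finite[OF x] by (intro infsum_finite) auto
  also have "\<dots> = c * ((\<Sum>y\<in>insert x (set_pmf (K x)). pmf (K x) y) - pmf (K x) x)"
    using K_finite[OF x] by (simp add: sum.insert_remove sum_distrib_left)
  also have "(\<Sum>y\<in>insert x (set_pmf (K x)). pmf (K x) y) = 1"
    using K_finite[OF x] by (intro sum_pmf_eq_1) auto
  finally show ?thesis .
qed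

definition poisson_semigroup :: "real \<Rightarrow> 's \<Rightarrow> 's pmf" where
  "poisson_semigroup t x =
     (if t \<le> 0 then return_pmf x
      else bind_pmf (poisson_pmf (c * t)) (\<lambda>n. kernel_power K n x))"

lemma kernel_power_closed: "x \<in> S \<Longrightarrow> set_pmf (kernel_power K n x) \<subseteq> S"
  using K_closed by (induction n arbitrary: x) fastforce+

lemma poisson_semigroup_add:
  assumes "s \<ge> 0" "t \<ge> 0"
  shows "poisson_semigroup (s + t) x = bind_pmf (poisson_semigroup s x) (poisson_semigroup t)"
proof (cases "s = 0 \<or> t = 0")
  case True
  have "poisson_semigroup 0 = return_pmf"
    by (simp add: poisson_semigroup_def fun_eq_iff)
  then show ?thesis
    using True by (auto simp: bind_return_pmf bind_return_pmf')
next
  case False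
  then have st: "s > 0" "t > 0"
    using assms by auto
  have "bind_pmf (poisson_semigroup s x) (poisson_semigroup t) =
      bind_pmf (poisson_pmf (c * s)) (\<lambda>m. bind_pmf (kernel_power K m x) (\<lambda>y.
        bind_pmf (poisson_pmf (c * t)) (\<lambda>n. kernel_power K n y)))"
    using st by (simp add: poisson_semigroup_def bind_assoc_pmf cong: bind_pmf_cong)
  also have "\<dots> = bind_pmf (poisson_pmf (c * s)) (\<lambda>m. bind_pmf (poisson_pmf (c * t)) (\<lambda>n.
        bind_pmf (kernel_power K m x) (\<lambda>y. kernel_power K n y)))"
    by (subst bind_commute_pmf) simp
  also have "\<dots> = bind_pmf (bind_pmf (poisson_pmf (c * s))
        (\<lambda>m. map_pmf ((+) m) (poisson_pmf (c * t)))) (\<lambda>n. kernel_power K n x)"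
    by (simp add: kernel_power_add bind_assoc_pmf bind_map_pmf)
  also have "\<dots> = poisson_semigroup (s + t) x"
    using st c_pos by (simp add: poisson_add poisson_semigroup_def algebra_simps)
  finally show ?thesis ..
qed

lemma poisson_semigroup_rate:
  "((\<lambda>h. (pmf (poisson_semigroup h x) y - of_bool (y = x)) / h) \<longlongrightarrow>
     c * (pmf (K x) y - of_bool (y = x))) (at_right 0)"
proof -
  define b where "b n = pmf (kernel_power K n x) y" for n
  have b01: "b 0 = of_bool (y = x)" "b 1 = pmf (K x) y"
  proof -
    have "kernel_power K 0 = return_pmf"
      by (simp add: fun_eq_iff)
    then show "b 0 = of_bool (y = x)" "b 1 = pmf (K x) y"
      by (auto simp: b_def bind_return_pmf' indicator_def)
  qed
  define e where "e h = exp (- (c * h)) * (b 0 + c * h * b 1)" for h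
  have est: "\<bar>pmf (poisson_semigroup h x) y - e h\<bar> \<le> 1 - exp (- (c * h)) * (1 + c * h)"
    if "h > 0" for h
  proof -
    have "pmf (poisson_semigroup h x) y = measure_pmf.expectation (poisson_pmf (c * h)) b"
      using that unfolding b_def[abs_def] by (simp add: poisson_semigroup_def pmf_bind)
    moreover have "(\<Sum>z\<in>{0, 1}. pmf (poisson_pmf (c * h)) z * b z) = e h"
      "(\<Sum>z\<in>{0, 1}. pmf (poisson_pmf (c * h)) z) = exp (- (c * h)) * (1 + c * h)"
      using that c_pos by (auto simp: e_def algebra_simps)
    ultimately show ?thesis
      using expectation_finite_part[of "{0, 1}" b "poisson_pmf (c * h)"]
      by (auto simp: b_def pmf_le_1)
  qed
  have "((\<lambda>h. (e h - b 0) / h) \<longlongrightarrow> c * (b 1 - b 0)) (at_right 0)"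
  proof -
    have "((\<lambda>h. (exp (- (c * h)) - 1) / h) \<longlongrightarrow> - c) (at_right 0)"
      "((\<lambda>h. exp (- (c * h)) * c) \<longlongrightarrow> c) (at_right 0)"
      using c_pos by real_asymp+
    then have "((\<lambda>h. b 0 * ((exp (- (c * h)) - 1) / h) + b 1 * (exp (- (c * h)) * c)) \<longlongrightarrow>
        b 0 * (- c) + b 1 * c) (at_right 0)"
      by (intro tendsto_intros)
    also have "b 0 * (- c) + b 1 * c = c * (b 1 - b 0)"
      by (simp add: algebra_simps)
    finally show ?thesis
      by (rule Lim_transform_eventually)
        (auto simp: eventually_at_filter e_def field_simps)
  qed
  moreover have "((\<lambda>h. (pmf (poisson_semigroup h x) y - e h) / h) \<longlongrightarrow> 0) (at_right 0)"
  proof (rule Lim_null_comparison)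
    show "((\<lambda>h. (1 - exp (- (c * h)) * (1 + c * h)) / h) \<longlongrightarrow> 0) (at_right 0)"
      using c_pos by real_asymp
    show "\<forall>\<^sub>F h in at_right 0. norm ((pmf (poisson_semigroup h x) y - e h) / h)
        \<le> (1 - exp (- (c * h)) * (1 + c * h)) / h"
      using eventually_at_right_less[of 0]
    proof eventually_elim
      case (elim h)
      then show ?case
        using divide_right_mono[OF est[OF elim], of h] by (simp add: abs_divide)
    qed
  qed
  ultimately have "((\<lambda>h. (pmf (poisson_semigroup h x) y - e h) / h + (e h - b 0) / h) \<longlongrightarrow>
      0 + c * (b 1 - b 0)) (at_right 0)"
    by (intro tendsto_add)
  then show ?thesis
    unfolding b01 by (simp flip: add_divide_distrib)
qed

theorem transition_function_exists: "transition_function S R poisson_semigroup"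
  unfolding transition_function_def
proof (intro conjI allI ballI impI)
  fix t x assume "x \<in> S"
  then show "set_pmf (poisson_semigroup t x) \<subseteq> S"
    using kernel_power_closed[of x]
    by (cases "t \<le> 0") (auto simp: poisson_semigroup_def)
next
  fix x y assume "x \<in> S" "y \<in> S" "y \<noteq> x"
  then show "((\<lambda>h. pmf (poisson_semigroup h x) y / h) \<longlongrightarrow> R x y) (at_right 0)"
    using poisson_semigroup_rate[of x y] by (simp add: R_eq)
next
  fix x assume "x \<in> S"
  then show "((\<lambda>h. (1 - pmf (poisson_semigroup h x) x) / h) \<longlongrightarrow> (\<Sum>\<^sub>\<infinity>y\<in>S - {x}. R x y)) (at_right 0)"
    using tendsto_minus[OF poisson_semigroup_rate[of x x]]
    by (simp add: exit_rate minus_divide_left algebra_simps)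
qed (auto simp: poisson_semigroup_def[of 0] poisson_semigroup_add)

definition gen :: "'s \<Rightarrow> 's \<Rightarrow> real" where
  "gen x z = c * (pmf (K x) z - of_bool (z = x))"

definition supp :: "'s \<Rightarrow> 's set" where
  "supp x = insert x (set_pmf (K x))"

lemma supp: assumes "x \<in> S" shows "finite (supp x)" "supp x \<subseteq> S" "x \<in> supp x"
  using K_finite[OF assms] K_closed[OF assms] assms by (auto simp: supp_def)

lemma sum_gen: assumes "x \<in> S" shows "(\<Sum>z\<in>supp x. gen x z) = 0"
proof -
  have "(\<Sum>z\<in>supp x. pmf (K x) z) = 1"
    using supp[OF assms] by (intro sum_pmf_eq_1) (auto simp: supp_def)
  moreover have "(\<Sum>z\<in>supp x. of_bool (z = x) :: real) = 1"
    using supp[OF assms] by (simp add: of_bool_def)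
  ultimately show ?thesis
    by (simp add: gen_def sum_subtractf flip: sum_distrib_left)
qed

lemma sum_abs_gen: assumes "x \<in> S" shows "(\<Sum>z\<in>supp x. \<bar>gen x z\<bar>) \<le> 2 * c"
proof -
  have "(\<Sum>z\<in>supp x. \<bar>gen x z\<bar>) \<le> (\<Sum>z\<in>supp x. c * (pmf (K x) z + of_bool (z = x)))"
  proof (rule sum_mono)
    fix z
    have "\<bar>pmf (K x) z - of_bool (z = x)\<bar> \<le> pmf (K x) z + of_bool (z = x)"
      using pmf_nonneg[of "K x" z] by (simp add: abs_le_iff)
    then show "\<bar>gen x z\<bar> \<le> c * (pmf (K x) z + of_bool (z = x))"
      using c_pos unfolding gen_def abs_mult by (intro mult_mono) auto
  qed
  also have "(\<Sum>z\<in>supp x. pmf (K x) z) = 1"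
    using supp[OF assms] by (intro sum_pmf_eq_1) (auto simp: supp_def)
  then have "(\<Sum>z\<in>supp x. c * (pmf (K x) z + of_bool (z = x))) = 2 * c"
    using supp[OF assms] by (simp add: sum.distrib of_bool_def flip: sum_distrib_left)
  finally show ?thesis .
qed

definition step_error :: "(real \<Rightarrow> 's \<Rightarrow> 's pmf) \<Rightarrow> 's \<Rightarrow> real \<Rightarrow> real" where
  "step_error P x h = 2 * (\<Sum>z\<in>supp x. \<bar>pmf (P h x) z - of_bool (z = x) - h * gen x z\<bar>)"

lemma step_error_tendsto:
  assumes P: "transition_function S R P" and x: "x \<in> S"
  shows "((\<lambda>h. step_error P x h / h) \<longlongrightarrow> 0) (at_right 0)"
proof -
  have lim: "((\<lambda>h. (pmf (P h x) z - of_bool (z = x)) / h) \<longlongrightarrow> gen x z) (at_right 0)"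
    if "z \<in> S" for z
  proof (cases "z = x")
    case True
    have "((\<lambda>h. (1 - pmf (P h x) x) / h) \<longlongrightarrow> c * (1 - pmf (K x) x)) (at_right 0)"
      using P x by (auto simp: transition_function_def exit_rate)
    from tendsto_minus[OF this] show ?thesis
      using True by (simp add: gen_def minus_divide_left algebra_simps)
  next
    case False
    then show ?thesis
      using P x that by (auto simp: transition_function_def gen_def R_eq)
  qed
  have "((\<lambda>h. 2 * (\<Sum>z\<in>supp x. \<bar>(pmf (P h x) z - of_bool (z = x)) / h - gen x z\<bar>)) \<longlongrightarrow>
      2 * (\<Sum>z\<in>supp x. \<bar>gen x z - gen x z\<bar>)) (at_right 0)"
    using supp[OF x] by (intro tendsto_intros lim) auto
  then have "((\<lambda>h. 2 * (\<Sum>z\<in>supp x. \<bar>(pmf (P h x) z - of_bool (z = x)) / h - gen x z\<bar>)) \<longlongrightarrow> 0)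
      (at_right 0)"
    by simp
  moreover have "\<bar>(pmf (P h x) z - of_bool (z = x)) / h - gen x z\<bar> =
      \<bar>pmf (P h x) z - of_bool (z = x) - h * gen x z\<bar> / h" if "h > 0" for h z
  proof -
    have "(pmf (P h x) z - of_bool (z = x)) / h - gen x z =
        (pmf (P h x) z - of_bool (z = x) - h * gen x z) / h"
      using that by (simp add: field_simps)
    then show ?thesis
      using that by (simp add: abs_divide)
  qed
  then have "\<forall>\<^sub>F h in at_right 0.
      2 * (\<Sum>z\<in>supp x. \<bar>(pmf (P h x) z - of_bool (z = x)) / h - gen x z\<bar>) = step_error P x h / h"
    by (auto simp: eventually_at_filter step_error_def sum_divide_distrib sum_distrib_left)
  ultimately show ?thesis
    by (rule Lim_transform_eventually)
qed

lemma step_error_bound: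
  fixes g :: "'s \<Rightarrow> real"
  assumes x: "x \<in> S" and g: "\<And>z. 0 \<le> g z" "\<And>z. g z \<le> 1"
  shows "\<bar>measure_pmf.expectation (P h x) g - g x - h * (\<Sum>z\<in>supp x. gen x z * g z)\<bar>
    \<le> step_error P x h"
proof -
  define d where "d z = pmf (P h x) z - of_bool (z = x) - h * gen x z" for z
  have unit: "(\<Sum>z\<in>supp x. of_bool (z = x) * f z) = f x" for f :: "'s \<Rightarrow> real"
    using supp[OF x] by (simp add: of_bool_def if_distrib[of "\<lambda>u. u * _"] cong: if_cong)
  have pmf_eq: "pmf (P h x) z = of_bool (z = x) + h * gen x z + d z" for z
    by (simp add: d_def)
  have A: "(\<Sum>z\<in>supp x. pmf (P h x) z * g z) =
      g x + h * (\<Sum>z\<in>supp x. gen x z * g z) + (\<Sum>z\<in>supp x. d z * g z)"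
    using unit[of g] unfolding pmf_eq
    by (simp add: algebra_simps sum.distrib sum_distrib_left)
  have B: "(\<Sum>z\<in>supp x. pmf (P h x) z) = 1 + (\<Sum>z\<in>supp x. d z)"
    using unit[of "\<lambda>_. 1"] sum_gen[OF x] unfolding pmf_eq
    by (simp add: sum.distrib flip: sum_distrib_left)
  have "\<bar>\<Sum>z\<in>supp x. d z * g z\<bar> \<le> (\<Sum>z\<in>supp x. \<bar>d z\<bar>)"
    using g by (intro order_trans[OF sum_abs] sum_mono) (auto simp: abs_mult intro!: mult_left_le)
  moreover have "\<bar>\<Sum>z\<in>supp x. d z\<bar> \<le> (\<Sum>z\<in>supp x. \<bar>d z\<bar>)"
    by (rule sum_abs)
  ultimately show ?thesis
    using expectation_finite_part[OF supp(1)[OF x], of g "P h x"] g A B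
    unfolding step_error_def d_def[symmetric] by (auto simp: abs_le_iff)
qed

theorem transition_function_unique:
  assumes P: "transition_function S R P" and Q: "transition_function S R Q"
    and "t \<ge> 0" and "x \<in> S"
  shows "P t x = Q t x"
proof -
  have P0: "P 0 x = return_pmf x" and Q0: "Q 0 x = return_pmf x" if "x \<in> S" for x
    using P Q that by (auto simp: transition_function_def)
  have PC: "P (s + t) x = bind_pmf (P s x) (P t)" and QC: "Q (s + t) x = bind_pmf (Q s x) (Q t)"
    if "s \<ge> 0" "t \<ge> 0" "x \<in> S" for s t x
    using P Q that by (auto simp: transition_function_def)
  have contract: "\<bar>pmf (P t x) y - pmf (Q t x) y\<bar> \<le> (1 / 2) ^ k"
    if "0 \<le> t" "t \<le> 1 / (4 * c)" "x \<in> S" for k t x y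
    using that
  proof (induction k arbitrary: t x)
    case 0
    then show ?case
      using pmf_le_1[of "P t x" y] pmf_le_1[of "Q t x" y] pmf_nonneg[of "P t x" y]
        pmf_nonneg[of "Q t x" y] by (simp add: abs_le_iff del: pmf_nonneg)
  next
    case (Suc k)
    define W :: real where "W = (1 / 2) ^ k"
    define w where "w s z = pmf (P s z) y - pmf (Q s z) y" for s z
    define e where "e h = step_error P x h + step_error Q x h" for h
    have step: "\<bar>w (h + s) x - w s x\<bar> \<le> h * (2 * c * W) + e h"
      if "0 \<le> h" "0 \<le> s" "s \<le> t" for h s
    proof -
      have "w (h + s) x = measure_pmf.expectation (P h x) (\<lambda>z. pmf (P s z) y)
          - measure_pmf.expectation (Q h x) (\<lambda>z. pmf (Q s z) y)"
        using that Suc.prems by (simp add: w_def PC QC pmf_bind)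
      moreover have "(\<Sum>z\<in>supp x. gen x z * w s z) = (\<Sum>z\<in>supp x. gen x z * pmf (P s z) y)
          - (\<Sum>z\<in>supp x. gen x z * pmf (Q s z) y)"
        by (simp add: w_def algebra_simps sum_subtractf)
      ultimately have "\<bar>w (h + s) x - w s x - h * (\<Sum>z\<in>supp x. gen x z * w s z)\<bar> \<le> e h"
        using step_error_bound[OF Suc.prems(3), of "\<lambda>z. pmf (P s z) y" P h]
          step_error_bound[OF Suc.prems(3), of "\<lambda>z. pmf (Q s z) y" Q h]
        by (simp add: e_def w_def pmf_le_1 right_diff_distrib abs_le_iff)
      moreover have "\<bar>h * (\<Sum>z\<in>supp x. gen x z * w s z)\<bar> \<le> h * (2 * c * W)"
      proof -
        have "\<bar>\<Sum>z\<in>supp x. gen x z * w s z\<bar> \<le> (\<Sum>z\<in>supp x. \<bar>gen x z\<bar> * W)"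
          using Suc.IH[of s] Suc.prems that supp[OF Suc.prems(3)]
          by (intro order_trans[OF sum_abs] sum_mono)
            (auto simp: abs_mult w_def W_def intro!: mult_left_mono)
        also have "\<dots> \<le> 2 * c * W"
          unfolding sum_distrib_right[symmetric] using sum_abs_gen[OF Suc.prems(3)]
          by (intro mult_right_mono) (auto simp: W_def)
        finally show ?thesis
          using that by (simp add: abs_mult mult_left_mono)
      qed
      ultimately show ?thesis
        by linarith
    qed
    have bound: "\<bar>w t x\<bar> \<le> t * (2 * c * W) + real (Suc n) * e (t / real (Suc n))" for n
    proof -
      define h where "h = t / real (Suc n)"
      have h: "0 \<le> h" "real (Suc n) * h = t"
        using Suc.prems by (auto simp: h_def)
      have "\<bar>w (real j * h) x\<bar> \<le> real j * (h * (2 * c * W) + e h)" if "j \<le> Suc n" for j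
        using that
      proof (induction j)
        case 0
        then show ?case
          using P0 Q0 Suc.prems by (simp add: w_def)
      next
        case (Suc j)
        have "real j * h \<le> t"
          using Suc.prems h by (metis Suc_leD mult_right_mono of_nat_le_iff)
        then have "\<bar>w (h + real j * h) x - w (real j * h) x\<bar> \<le> h * (2 * c * W) + e h"
          using h by (intro step) auto
        moreover have "w (h + real j * h) x = w (real (Suc j) * h) x"
          by (simp add: algebra_simps)
        moreover have "\<bar>w (real j * h) x\<bar> \<le> real j * (h * (2 * c * W) + e h)"
          using Suc by auto
        ultimately have "\<bar>w (real (Suc j) * h) x\<bar>
            \<le> real j * (h * (2 * c * W) + e h) + (h * (2 * c * W) + e h)"
          by (smt (verit))
        then show ?case
          by (simp add: algebra_simps)
      qed
      from this[of "Suc n"] have "\<bar>w t x\<bar> \<le> real (Suc n) * (h * (2 * c * W) + e h)"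
        using h by simp
      also have "\<dots> = t * (2 * c * W) + real (Suc n) * e h"
        using h(2) by (metis distrib_left mult.assoc)
      finally show ?thesis
        by (simp only: h_def)
    qed
    have "\<bar>w t x\<bar> \<le> t * (2 * c * W)"
    proof (cases "t = 0")
      case True
      then show ?thesis
        using P0 Q0 Suc.prems by (simp add: w_def)
    next
      case False
      then have t: "t > 0"
        using Suc.prems by simp
      have "((\<lambda>h. e h / h) \<longlongrightarrow> 0) (at_right 0)"
        using tendsto_add[OF step_error_tendsto[OF P Suc.prems(3)]
            step_error_tendsto[OF Q Suc.prems(3)]]
        by (simp add: e_def add_divide_distrib)
      moreover have "filterlim (\<lambda>n. t / real (Suc n)) (at_right 0) sequentially"
        using t by real_asymp
      ultimately have "(\<lambda>n. e (t / real (Suc n)) / (t / real (Suc n))) \<longlonglongrightarrow> 0"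
        by (rule filterlim_compose)
      then have "(\<lambda>n. t * (2 * c * W) + t * (e (t / real (Suc n)) / (t / real (Suc n))))
          \<longlonglongrightarrow> t * (2 * c * W) + t * 0"
        by (intro tendsto_intros)
      moreover have "t * (e (t / real (Suc n)) / (t / real (Suc n))) =
          real (Suc n) * e (t / real (Suc n))" for n
        using t by (simp add: divide_simps del: of_nat_Suc)
      ultimately have "(\<lambda>n. t * (2 * c * W) + real (Suc n) * e (t / real (Suc n)))
          \<longlonglongrightarrow> t * (2 * c * W)"
        by (simp del: of_nat_Suc)
      then show ?thesis
        using bound by (intro LIMSEQ_le_const) auto
    qed
    also have "t * (2 * c * W) \<le> 1 / (4 * c) * (2 * c * W)"
      using Suc.prems c_pos by (intro mult_right_mono) (auto simp: W_def)
    also have "\<dots> = (1 / 2) ^ Suc k"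
      using c_pos by (simp add: W_def)
    finally show ?case
      by (simp add: w_def)
  qed
  have short: "P t x = Q t x" if "0 \<le> t" "t \<le> 1 / (4 * c)" "x \<in> S" for t x
  proof (rule pmf_eqI)
    fix y
    have "(\<lambda>k. (1 / 2 :: real) ^ k) \<longlonglongrightarrow> 0"
      by (rule LIMSEQ_realpow_zero) auto
    then have "\<bar>pmf (P t x) y - pmf (Q t x) y\<bar> \<le> 0"
      using contract[OF that, of y] by (intro LIMSEQ_le_const) auto
    then show "pmf (P t x) y = pmf (Q t x) y"
      by simp
  qed
  obtain n :: nat where n: "t * (4 * c) \<le> real n"
    using real_arch_simple by blast
  define h where "h = t / real (Suc n)"
  have h: "0 \<le> h" "h \<le> 1 / (4 * c)" "real (Suc n) * h = t"
    using n \<open>t \<ge> 0\<close> c_pos by (auto simp: h_def field_simps)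
  have "P (real k * h) x = Q (real k * h) x" if "x \<in> S" for k x
    using that
  proof (induction k arbitrary: x)
    case 0
    then show ?case
      by (simp add: P0 Q0)
  next
    case (Suc k)
    have "real (Suc k) * h = h + real k * h"
      by (simp add: algebra_simps)
    moreover have "set_pmf (Q h x) \<subseteq> S"
      using Q h Suc.prems by (auto simp: transition_function_def)
    ultimately show ?case
      using Suc h short[OF h(1,2)] by (auto simp: PC QC intro!: bind_pmf_cong)
  qed
  from this[OF \<open>x \<in> S\<close>, of "Suc n"] show ?thesis
    by (simp only: h)
qed

end

section \<open>The Fleming-Viot process is well defined\<close>

definition fv_step :: "real \<Rightarrow> nat \<Rightarrow> nat list \<Rightarrow> nat list pmf" where
  "fv_step p N \<xi> =
     bind_pmf (pmf_of_set {..<N}) (\<lambda>i. bind_pmf (bernoulli_pmf p) (\<lambda>up.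
       if up then return_pmf (\<xi>[i := \<xi> ! i + 1])
       else if \<xi> ! i = 1 then map_pmf (\<lambda>j. \<xi>[i := \<xi> ! j]) (pmf_of_set ({..<N} - {i}))
       else return_pmf (\<xi>[i := \<xi> ! i - 1])))"

lemma others_nonempty: "2 \<le> N \<Longrightarrow> {..<N} - {i} \<noteq> {}" for N i :: nat
proof
  assume "2 \<le> N" "{..<N} - {i} = {}"
  moreover from this have "0 \<in> {..<N}" "1 \<in> {..<N}"
    by simp_all
  ultimately have "0 = i" "1 = i"
    by blast+
  then show False
    by simp
qed

lemma fv_rate_eq_step:
  assumes "N \<ge> 2" "0 < p" "q = 1 - p" "0 < q"
  shows "fv_rate p q N \<xi> \<eta> = real N * pmf (fv_step p N \<xi>) \<eta>"
proof -
  have jump: "pmf (map_pmf (\<lambda>j. \<xi>[i := \<xi> ! j]) (pmf_of_set ({..<N} - {i}))) \<eta> =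
      (\<Sum>j\<in>{..<N} - {i}. of_bool (\<eta> = \<xi>[i := \<xi> ! j])) / (real N - 1)" if "i < N" for i
  proof -
    have "real (card ({..<N} - {i})) = real N - 1"
      using that assms(1) by (simp add: of_nat_diff)
    then show ?thesis
      using others_nonempty[OF assms(1), of i]
      by (simp add: map_pmf_def pmf_bind_pmf_of_set indicator_def of_bool_def eq_commute[of \<eta>])
  qed
  have one: "pmf (return_pmf a) \<eta> = of_bool (\<eta> = a)" for a
    by (simp add: indicator_def)
  have "pmf (fv_step p N \<xi>) \<eta> = (\<Sum>i<N. p * of_bool (\<eta> = \<xi>[i := \<xi> ! i + 1])
      + q * (if \<xi> ! i = 1
             then (\<Sum>j\<in>{..<N} - {i}. of_bool (\<eta> = \<xi>[i := \<xi> ! j])) / (real N - 1)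
             else of_bool (\<eta> = \<xi>[i := \<xi> ! i - 1]))) / real N"
    unfolding fv_step_def using assms
    by (subst pmf_bind_pmf_of_set)
      (auto simp: lessThan_empty_iff pmf_bind[of "bernoulli_pmf p"] jump one mult.commute
        intro!: arg_cong2[of _ _ _ _ "(/)"] sum.cong)
  then show ?thesis
    using assms(1) unfolding fv_rate_def
    by (auto simp: sum_distrib_left sum_divide_distrib simp del: sum_of_bool_eq sum_mult_of_bool_eq
        intro!: sum.cong)
qed

lemma uniformizable_fv:
  assumes "N \<ge> 2" "0 < p" "q = 1 - p" "0 < q"
  shows "uniformizable (configs N) (fv_rate p q N) (real N) (fv_step p N)"
proof
  fix \<xi> assume \<xi>: "\<xi> \<in> configs N"
  have pos: "1 \<le> \<xi> ! i" if "i < N" for i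
    using \<xi> that by (auto simp: configs_def)
  have upd: "\<xi>[i := a] \<in> configs N" if "1 \<le> a" for i a
    using \<xi> that set_update_subset_insert[of \<xi> i a] by (fastforce simp: configs_def)
  have "N \<noteq> 0"
    using assms by simp
  then show "set_pmf (fv_step p N \<xi>) \<subseteq> configs N"
    using others_nonempty[OF assms(1)] pos
    by (auto simp: fv_step_def lessThan_empty_iff split: if_splits intro!: upd)
       (metis Suc_leI diff_is_0_eq le_antisym linorder_not_less pos zero_less_diff One_nat_def)+
  show "finite (set_pmf (fv_step p N \<xi>))"
    using others_nonempty[OF assms(1)] \<open>N \<noteq> 0\<close>
    by (auto simp: fv_step_def lessThan_empty_iff)
qed (use assms in \<open>auto simp: fv_rate_eq_step\<close>)

theorem transition_function_fleming_viot:
  assumes "N \<ge> 2" "0 < p" "q = 1 - p" "0 < q"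
  shows "transition_function (configs N) (fv_rate p q N) (fleming_viot p q N)"
proof -
  interpret uniformizable "configs N" "fv_rate p q N" "real N" "fv_step p N"
    by (rule uniformizable_fv[OF assms])
  show ?thesis
    unfolding fleming_viot_def using transition_function_exists
    by (rule someI[where P = "transition_function (configs N) (fv_rate p q N)"])
qed

theorem fleming_viot_unique:
  assumes "N \<ge> 2" "0 < p" "q = 1 - p" "0 < q"
    and "transition_function (configs N) (fv_rate p q N) P" "t \<ge> 0" "\<xi> \<in> configs N"
  shows "P t \<xi> = fleming_viot p q N t \<xi>"
proof -
  interpret uniformizable "configs N" "fv_rate p q N" "real N" "fv_step p N"
    by (rule uniformizable_fv[OF assms(1-4)])
  show ?thesis
    using transition_function_fleming_viot[OF assms(1-4)] assms(5-7)
    by (intro transition_function_unique)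
qed

end

theory Submission
  imports Defs
begin

text \<open>
  Let \<open>f\<close> be the exponential mass, the sum of \<open>base\<close> to the power \<open>\<xi> ! i\<close> over all walks, and track
  a set \<open>D\<close> of walks: initially the rightmost one, later all its copies. While no tracked walk sits
  at site 1, the set \<open>D\<close> can only grow, and it grows at \<open>card D\<close> times the rate at which any single
  walk is copied. Copying increases \<open>sqrt f\<close>, but the simultaneous growth of \<open>D\<close> compensates this in
  \<open>sqrt f / card D\<close>, which therefore decays exponentially through the drift alone. As \<open>card D \<le> N\<close>,
  after a time of order \<open>ln N\<close> the expectation of \<open>sqrt f\<close>, hence of an exponential of the maximum,
  has dropped by a factor \<open>N\<close>, provided the rightmost walk starts so high that its copies do not
  reach site 1. Smaller exponents follow by interpolation. Since configurations with bounded maximum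
  form a finite set and the configuration with all walks at 1 is accessible, this drift condition
  gives existence and uniqueness of the invariant measure by Harris' theorem.
\<close>

section \<open>Kernels on discrete spaces\<close>

text \<open>The drift alone does not make \<open>mass\<close> decrease: if most walks sit at site 1
  and a few high ones carry the mass, kills multiply it at a rate near \<open>q\<close>, and
  \<open>q > 1 / 2 \<ge> gap\<close>. The division by \<open>card D\<close> has to absorb this. With
  \<open>z = card D\<close>, a copied walk lies in \<open>D\<close> with probability
  \<open>z / (N - 1)\<close>, and then dividing by \<open>z + 1\<close> instead of \<open>z\<close>
  loses the fraction \<open>1 / (z + 1)\<close>. For \<open>z = 1\<close> the average loss is only
  half of the relative gain \<open>1 / (N - 1)\<close> of the mass. The square root halves that gain
  by concavity; this is where its exponent comes from. The pair of configuration and tracked set is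
  never built as a process. Instead, the law after \<open>n\<close> jumps is bounded for all
  \<open>D\<close> at once, by induction on \<open>n\<close> with \<open>D\<close> changing along
  the first move. A summand with \<open>depth (1 / 2) D\<close> pays for tracked walks that reach
  site 1. Jumps occur at total rate \<open>N\<close>, so factors like
  \<open>1 - gap / (2 * N)\<close> and \<open>1 + 6 / N\<close> per jump become exponentials in time
  that do not depend on \<open>N\<close>.\<close>

lemma nn_integral_poisson_power:
  fixes r x :: real
  assumes "r > 0" "x \<ge> 0"
  shows "(\<integral>\<^sup>+ n. ennreal (x ^ n) \<partial>measure_pmf (poisson_pmf r)) = ennreal (exp (r * (x - 1)))"
proof -
  have sums: "(\<lambda>n. (r * x) ^ n / fact n * exp (- r)) sums (exp (r * x) * exp (- r))"
    using exp_converges[of "r * x"] by (intro sums_mult2) (simp add: scaleR_conv_of_real field_simps)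
  have "(\<integral>\<^sup>+ n. ennreal (x ^ n) \<partial>measure_pmf (poisson_pmf r)) =
      (\<Sum>n. ennreal (pmf (poisson_pmf r) n) * ennreal (x ^ n))"
    by (simp add: nn_integral_measure_pmf nn_integral_count_space_nat)
  also have "\<dots> = (\<Sum>n. ennreal ((r * x) ^ n / fact n * exp (- r)))"
    using assms by (intro suminf_cong)
      (simp add: power_mult_distrib algebra_simps flip: ennreal_mult)
  also have "\<dots> = ennreal (exp (r * x) * exp (- r))"
    using sums assms by (intro suminf_ennreal_eq) auto
  also have "exp (r * x) * exp (- r) = exp (r * (x - 1))"
    by (simp add: algebra_simps flip: exp_add)
  finally show ?thesis .
qed

lemma expectation_bind_pmf_bounded:
  fixes f :: "'b \<Rightarrow> real"
  assumes "\<And>y. \<bar>f y\<bar> \<le> B"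
  shows "measure_pmf.expectation (bind_pmf M K) f =
    measure_pmf.expectation M (\<lambda>x. measure_pmf.expectation (K x) f)"
  unfolding measure_pmf_bind using assms
  by (subst integral_bind[where K = "count_space UNIV" and B = B and B' = 1])
    (auto simp: measure_pmf.emeasure_space_1 measure_pmf_in_subprob_space)

text \<open>The support is countable, so the images of initial segments under an enumeration of it
  exhaust the mass.\<close>

lemma finite_approximation_pmf:
  assumes "\<epsilon> > 0"
  obtains F where "finite F" "measure_pmf.prob M F > 1 - \<epsilon>"
proof -
  define A where "A k = from_nat_into (set_pmf M) ` {..k :: nat}" for k
  have "(\<Union>k. A k) = set_pmf M"
    using range_from_nat_into[OF set_pmf_not_empty countable_set_pmf, of M]
    by (simp add: A_def UN_atMost_UNIV flip: image_UN)
  moreover have "(\<lambda>k. measure_pmf.prob M (A k)) \<longlonglongrightarrow> measure_pmf.prob M (\<Union>k. A k)"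
    by (intro measure_pmf.finite_Lim_measure_incseq) (auto simp: A_def incseq_def)
  moreover have "measure_pmf.prob M (set_pmf M) = 1"
    by (subst measure_pmf.prob_eq_1) (auto simp: AE_measure_pmf)
  ultimately have "(\<lambda>k. measure_pmf.prob M (A k)) \<longlonglongrightarrow> 1"
    by simp
  then have "\<forall>\<^sub>F k in sequentially. measure_pmf.prob M (A k) > 1 - \<epsilon>"
    using assms by (intro order_tendstoD) auto
  then obtain k where "measure_pmf.prob M (A k) > 1 - \<epsilon>"
    by (meson eventually_sequentially order_refl)
  moreover have "finite (A k)" by (simp add: A_def)
  ultimately show ?thesis using that by blast
qed

lemma expectation_unit_interval:
  fixes f :: "'a \<Rightarrow> real"
  assumes "\<And>y. 0 \<le> f y" "\<And>y. f y \<le> 1"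
  shows "integrable (measure_pmf M) f" "0 \<le> measure_pmf.expectation M f"
    "measure_pmf.expectation M f \<le> 1"
proof -
  show int: "integrable (measure_pmf M) f"
    using assms by (intro measure_pmf.integrable_const_bound[of _ 1] AE_pmfI) auto
  show "0 \<le> measure_pmf.expectation M f" using assms by (intro integral_nonneg_AE AE_pmfI) auto
  show "measure_pmf.expectation M f \<le> 1"
    using assms int by (intro measure_pmf.integral_le_const AE_pmfI) auto
qed

section \<open>Harris' theorem\<close>

text \<open>With finite level sets of \<open>V\<close>, the minorization condition of Harris reduces
  to one point \<open>z\<close> charged from everywhere: on a level set the finitely many values
  \<open>pmf (P x) z\<close> have a positive minimum.\<close>

locale harris_kernel =
  fixes S :: "'s set" and P :: "'s \<Rightarrow> 's pmf" and V :: "'s \<Rightarrow> real" and b :: real and z :: 's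
  assumes closed: "x \<in> S \<Longrightarrow> set_pmf (P x) \<subseteq> S"
    and V_nonneg: "0 \<le> V x"
    and b_nonneg: "0 \<le> b"
    and V_integrable: "x \<in> S \<Longrightarrow> integrable (P x) V"
    and V_drift: "x \<in> S \<Longrightarrow> measure_pmf.expectation (P x) V \<le> V x / 2 + b"
    and level_finite: "finite {x \<in> S. V x \<le> r}"
    and atom: "z \<in> S" "x \<in> S \<Longrightarrow> 0 < pmf (P x) z"
begin

text \<open>Integrating the drift condition directly would presuppose that \<open>V\<close> is
  integrable under \<open>\<mu>\<close>, so invariance is applied to \<open>min (V x) L\<close>. The
  difference \<open>min (V x) L - min (V x / 2) L\<close> has expectation at most \<open>b\<close>,
  equals \<open>V x / 2\<close> where \<open>V x \<le> L\<close>, and is nonnegative elsewhere.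
  Monotone convergence in \<open>L\<close> finishes.\<close>

lemma expectation_V_invariant:
  assumes \<mu>: "set_pmf \<mu> \<subseteq> S" "bind_pmf \<mu> P = \<mu>"
  shows "integrable \<mu> V" "measure_pmf.expectation \<mu> V \<le> 2 * b"
proof -
  have int: "integrable \<mu> (\<lambda>x. min (f x) L)" if "\<And>x. 0 \<le> f x" for L :: real and f :: "'s \<Rightarrow> real"
  proof (intro measure_pmf.integrable_const_bound[of _ "\<bar>L\<bar>"] AE_pmfI)
    show "norm (min (f x) L) \<le> \<bar>L\<bar>" for x
      using that[of x] by auto
  qed simp
  have trunc: "measure_pmf.expectation \<mu> (\<lambda>x. V x / 2 * of_bool (V x \<le> L)) \<le> b" if "L \<ge> 0" for L
  proof -
    have "measure_pmf.expectation \<mu> (\<lambda>x. min (V x) L) =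
        measure_pmf.expectation (bind_pmf \<mu> P) (\<lambda>x. min (V x) L)"
      using \<mu> by simp
    also have "\<dots> = measure_pmf.expectation \<mu> (\<lambda>x. measure_pmf.expectation (P x) (\<lambda>y. min (V y) L))"
    proof (rule expectation_bind_pmf_bounded)
      show "\<bar>min (V y) L\<bar> \<le> L" for y
        using V_nonneg[of y] that by auto
    qed
    also have "\<dots> \<le> measure_pmf.expectation \<mu> (\<lambda>x. b + min (V x / 2) L)"
    proof (rule integral_mono_AE)
      have bd: "0 \<le> measure_pmf.expectation (P x) (\<lambda>y. min (V y) L)"
        "measure_pmf.expectation (P x) (\<lambda>y. min (V y) L) \<le> L" for x
      proof -
        show "0 \<le> measure_pmf.expectation (P x) (\<lambda>y. min (V y) L)"
          using V_nonneg that by (intro integral_nonneg_AE AE_pmfI) auto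
        show "measure_pmf.expectation (P x) (\<lambda>y. min (V y) L) \<le> L"
          using V_nonneg that by (intro measure_pmf.integral_le_const AE_pmfI
            measure_pmf.integrable_const_bound[of _ L]) auto
      qed
      then show "integrable \<mu> (\<lambda>x. measure_pmf.expectation (P x) (\<lambda>y. min (V y) L))"
        by (intro measure_pmf.integrable_const_bound[of _ L] AE_pmfI) auto
      show "integrable \<mu> (\<lambda>x. b + min (V x / 2) L)"
        using int[of "\<lambda>x. V x / 2" L] V_nonneg by simp
      show "AE x in \<mu>. measure_pmf.expectation (P x) (\<lambda>y. min (V y) L) \<le> b + min (V x / 2) L"
      proof (rule AE_pmfI)
        fix x assume "x \<in> set_pmf \<mu>"
        then have x: "x \<in> S" using \<mu> by auto
        have "measure_pmf.expectation (P x) (\<lambda>y. min (V y) L) \<le> measure_pmf.expectation (P x) V"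
          using V_nonneg that by (intro integral_mono V_integrable x
            measure_pmf.integrable_const_bound[of _ L] AE_pmfI) auto
        then show "measure_pmf.expectation (P x) (\<lambda>y. min (V y) L) \<le> b + min (V x / 2) L"
          using V_drift[OF x] bd[of x] b_nonneg by auto
      qed
    qed
    also have "\<dots> = b + measure_pmf.expectation \<mu> (\<lambda>x. min (V x / 2) L)"
      using int[of "\<lambda>x. V x / 2" L] V_nonneg by simp
    finally have "measure_pmf.expectation \<mu> (\<lambda>x. min (V x) L) -
        measure_pmf.expectation \<mu> (\<lambda>x. min (V x / 2) L) \<le> b" by simp
    then have "measure_pmf.expectation \<mu> (\<lambda>x. min (V x) L - min (V x / 2) L) \<le> b"
      using int[of V L] int[of "\<lambda>x. V x / 2" L] V_nonneg by simp
    moreover have "measure_pmf.expectation \<mu> (\<lambda>x. V x / 2 * of_bool (V x \<le> L)) \<le>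
        measure_pmf.expectation \<mu> (\<lambda>x. min (V x) L - min (V x / 2) L)"
      using int[of V L] int[of "\<lambda>x. V x / 2" L] V_nonneg that
      by (intro integral_mono measure_pmf.integrable_const_bound[of _ L] AE_pmfI)
        (auto simp: min_def)
    ultimately show ?thesis by linarith
  qed
  have lim: "(\<lambda>k. ennreal (V x / 2 * of_bool (V x \<le> real k))) \<longlonglongrightarrow> ennreal (V x / 2)" for x
  proof (rule tendsto_eventually)
    show "\<forall>\<^sub>F k in sequentially. ennreal (V x / 2 * of_bool (V x \<le> real k)) = ennreal (V x / 2)"
      using eventually_ge_at_top[of "nat \<lceil>V x\<rceil>"] by eventually_elim (simp add: le_nat_iff nat_ceiling_le_eq)
  qed
  have mono: "incseq (\<lambda>k x. ennreal (V x / 2 * of_bool (V x \<le> real k)))"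
    using V_nonneg by (auto simp: incseq_def le_fun_def intro!: ennreal_leI)
  have "(\<integral>\<^sup>+ x. ennreal (V x / 2) \<partial>\<mu>) \<le> ennreal b"
  proof (rule LIMSEQ_le_const2)
    show "(\<lambda>k. \<integral>\<^sup>+ x. ennreal (V x / 2 * of_bool (V x \<le> real k)) \<partial>\<mu>) \<longlonglongrightarrow> (\<integral>\<^sup>+ x. ennreal (V x / 2) \<partial>\<mu>)"
      by (rule nn_integral_LIMSEQ[OF mono _ lim]) simp
    have "(\<integral>\<^sup>+ x. ennreal (V x / 2 * of_bool (V x \<le> real k)) \<partial>\<mu>) \<le> ennreal b" for k
    proof (subst nn_integral_eq_integral)
      show "integrable \<mu> (\<lambda>x. V x / 2 * of_bool (V x \<le> real k))"
        using V_nonneg by (intro measure_pmf.integrable_const_bound[of _ "real k"] AE_pmfI) auto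
    qed (use V_nonneg trunc[of "real k"] in \<open>auto intro!: ennreal_leI\<close>)
    then show "\<exists>K. \<forall>k\<ge>K. (\<integral>\<^sup>+ x. ennreal (V x / 2 * of_bool (V x \<le> real k)) \<partial>\<mu>) \<le> ennreal b"
      by blast
  qed
  then have half: "integrable \<mu> (\<lambda>x. V x / 2)" "measure_pmf.expectation \<mu> (\<lambda>x. V x / 2) \<le> b"
  proof -
    assume le: "(\<integral>\<^sup>+ x. ennreal (V x / 2) \<partial>\<mu>) \<le> ennreal b"
    show int: "integrable \<mu> (\<lambda>x. V x / 2)"
      using V_nonneg le by (intro integrableI_nonneg) (auto simp: top_unique less_top[symmetric] intro: le_less_trans)
    show "measure_pmf.expectation \<mu> (\<lambda>x. V x / 2) \<le> b"
      using le V_nonneg b_nonneg by (subst (asm) nn_integral_eq_integral[OF int]) (auto simp: ennreal_le_iff)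
  qed
  show "integrable \<mu> V" using integrable_mult_right[OF half(1), of 2] by simp
  show "measure_pmf.expectation \<mu> V \<le> 2 * b" using half by simp
qed

text \<open>Hairer and Mattingly's weighted metric; \<open>\<beta>\<close> is chosen so small that coupling at \<open>z\<close> wins on the
  level sets of \<open>V\<close>, while outside of them the drift wins.\<close>

definition weight :: "real \<Rightarrow> 's \<Rightarrow> 's \<Rightarrow> real" where
  "weight \<beta> x y = 1 + \<beta> * (V x + V y)"

lemma integrable_pair_V:
  assumes "x \<in> S" "y \<in> S"
  shows "integrable (pair_pmf (P x) (P y)) (\<lambda>u. V (fst u))"
    "integrable (pair_pmf (P x) (P y)) (\<lambda>u. V (snd u))"
  using integrable_map_pmf_eq[of fst "pair_pmf (P x) (P y)" V]
    integrable_map_pmf_eq[of snd "pair_pmf (P x) (P y)" V] V_integrable assms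
  by (simp_all add: map_fst_pair_pmf map_snd_pair_pmf)

text \<open>Two independent steps from a level set already meet with positive probability, since
  both may land at \<open>z\<close>. The integrand equals \<open>weight\<close> off the diagonal and
  is nonnegative on it, so it dominates the weighted distance of the two new points.\<close>

lemma independent_coupling_contracts:
  obtains \<beta> r where "\<beta> > 0" "0 \<le> r" "r < 1"
    "\<And>x y. x \<in> S \<Longrightarrow> y \<in> S \<Longrightarrow> measure_pmf.expectation (pair_pmf (P x) (P y))
      (\<lambda>u. of_bool (fst u \<noteq> snd u) + \<beta> * (V (fst u) + V (snd u))) \<le> r * weight \<beta> x y"
proof -
  \<comment> \<open>\<open>8 * b\<close> gives \<open>2 * b \<le> R / 4\<close>, so beyond
    \<open>R\<close> the drift turns \<open>v\<close> into at most \<open>3 / 4 * v\<close>. The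
    summand 8 keeps \<open>v\<close> away from 0, where no contraction would be left.\<close>
  define R where "R = 8 * b + 8"
  define L where "L = {x \<in> S. V x \<le> R}"
  have R: "R \<ge> 8" "2 * b \<le> R / 4" using b_nonneg by (auto simp: R_def)
  have fin: "finite L" unfolding L_def by (rule level_finite)
  \<comment> \<open>The inserted 1 covers an empty level set and gives
    \<open>\<epsilon> \<le> 1\<close>.\<close>
  define \<epsilon> where "\<epsilon> = Min (insert 1 ((\<lambda>x. pmf (P x) z) ` L))"
  have \<epsilon>: "\<epsilon> > 0" "\<epsilon> \<le> 1" "\<And>x. x \<in> L \<Longrightarrow> \<epsilon> \<le> pmf (P x) z"
    unfolding \<epsilon>_def using fin atom(2) by (auto simp: L_def intro: Min_le)
  define \<beta> where "\<beta> = \<epsilon>\<^sup>2 / (2 * R)"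
  \<comment> \<open>\<open>r1\<close> is the value at \<open>v = 8\<close> of
    \<open>(1 + 3 / 4 * \<beta> * v) / (1 + \<beta> * v)\<close>, which decreases in
    \<open>v\<close>. In \<open>r2\<close>, the coupling gains \<open>\<epsilon>\<^sup>2\<close> and
    the choice of \<open>\<beta>\<close> spends half of it on \<open>\<beta> * R\<close>.\<close>
  define r1 r2 where "r1 = 1 - 2 * \<beta> / (1 + 8 * \<beta>)" and "r2 = 1 - \<epsilon>\<^sup>2 / 2"
  define r where "r = max r1 r2"
  have \<beta>: "\<beta> > 0" using \<epsilon> R by (simp add: \<beta>_def)
  have r1: "r1 < 1" "r1 \<ge> 0" using \<beta> by (auto simp: r1_def field_simps)
  have r2: "r2 < 1" using \<epsilon> by (simp add: r2_def)
  show thesis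
  proof (rule that[of \<beta> r])
    fix x y assume xy: "x \<in> S" "y \<in> S"
    define v where "v = V x + V y"
    have v: "v \<ge> 0" using V_nonneg by (simp add: v_def)
    let ?M = "pair_pmf (P x) (P y)"
    have ne: "measure_pmf.expectation ?M (\<lambda>u. of_bool (fst u \<noteq> snd u)) \<le> 1 - pmf (P x) z * pmf (P y) z"
    proof -
      have "measure_pmf.expectation ?M (\<lambda>u. of_bool (fst u \<noteq> snd u)) \<le>
          measure_pmf.expectation ?M (\<lambda>u. 1 - indicator {(z, z)} u :: real)"
        by (intro integral_mono measure_pmf.integrable_const_bound[of _ 1] AE_pmfI)
          (auto simp: indicator_def)
      also have "\<dots> = 1 - pmf ?M (z, z)"
        using expectation_unit_interval(1)[of "indicator {(z, z)}" ?M]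
        by (subst Bochner_Integration.integral_diff) (auto simp: measure_pmf_single)
      finally show ?thesis by (simp add: pmf_pair)
    qed
    have "measure_pmf.expectation (P x) V + measure_pmf.expectation (P y) V \<le> (V x / 2 + b) + (V y / 2 + b)"
      by (intro add_mono V_drift xy)
    then have V_sum: "measure_pmf.expectation (P x) V + measure_pmf.expectation (P y) V \<le> v / 2 + 2 * b"
      by (simp add: v_def add_divide_distrib)
    have "measure_pmf.expectation ?M (\<lambda>u. of_bool (fst u \<noteq> snd u) + \<beta> * (V (fst u) + V (snd u))) =
        measure_pmf.expectation ?M (\<lambda>u. of_bool (fst u \<noteq> snd u)) +
        \<beta> * (measure_pmf.expectation (P x) V + measure_pmf.expectation (P y) V)"
      using integrable_pair_V[OF xy] expectation_unit_interval(1)[of "\<lambda>u. of_bool (fst u \<noteq> snd u)" ?M]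
      by simp
    also have "\<dots> \<le> (1 - pmf (P x) z * pmf (P y) z) + \<beta> * (v / 2 + 2 * b)"
      using \<beta> by (intro add_mono[OF ne] mult_left_mono V_sum) auto
    also have "\<dots> \<le> r * (1 + \<beta> * v)"
    proof (cases "v > R")
      case True
      have "(1 - pmf (P x) z * pmf (P y) z) + \<beta> * (v / 2 + 2 * b) \<le> 1 + \<beta> * (v / 2 + v / 4)"
        using True R \<beta> by (intro add_mono mult_left_mono) auto
      also have "\<dots> \<le> r1 * (1 + \<beta> * v)"
      proof -
        have "2 * \<beta> / (1 + 8 * \<beta>) * (1 + \<beta> * v) \<le> \<beta> * v / 4"
        proof -
          have "8 * (1 + \<beta> * v) \<le> v * (1 + 8 * \<beta>)"
            using True R by (simp add: algebra_simps)
          then have "\<beta> * (8 * (1 + \<beta> * v)) \<le> \<beta> * (v * (1 + 8 * \<beta>))"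
            using \<beta> by (intro mult_left_mono) auto
          then show ?thesis using \<beta> by (simp add: field_simps)
        qed
        moreover have "r1 * (1 + \<beta> * v) = 1 + \<beta> * v - 2 * \<beta> / (1 + 8 * \<beta>) * (1 + \<beta> * v)"
          by (simp only: r1_def left_diff_distrib mult_1)
        moreover have "\<beta> * (v / 2 + v / 4) = \<beta> * v - \<beta> * v / 4"
          by (simp add: algebra_simps)
        ultimately show ?thesis by linarith
      qed
      also have "\<dots> \<le> r * (1 + \<beta> * v)"
        using v \<beta> by (intro mult_right_mono) (auto simp: r_def)
      finally show ?thesis .
    next
      case False
      then have L: "x \<in> L" "y \<in> L"
        using xy V_nonneg[of x] V_nonneg[of y] by (auto simp: L_def v_def)
      have "\<epsilon> * \<epsilon> \<le> pmf (P x) z * pmf (P y) z"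
        using \<epsilon> L by (intro mult_mono) auto
      moreover have "\<beta> * (v / 2 + 2 * b) \<le> \<beta> * R"
        using False R \<beta> by (intro mult_left_mono) auto
      moreover have "\<beta> * R = \<epsilon>\<^sup>2 / 2" using R by (simp add: \<beta>_def)
      ultimately have "(1 - pmf (P x) z * pmf (P y) z) + \<beta> * (v / 2 + 2 * b) \<le> r2"
        by (simp add: r2_def power2_eq_square)
      also have "r2 \<le> r * 1" by (simp add: r_def)
      also have "\<dots> \<le> r * (1 + \<beta> * v)"
        using v \<beta> r1 by (intro mult_left_mono) (auto simp: r_def)
      finally show ?thesis .
    qed
    finally show "measure_pmf.expectation ?M
        (\<lambda>u. of_bool (fst u \<noteq> snd u) + \<beta> * (V (fst u) + V (snd u))) \<le> r * weight \<beta> x y"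
      by (simp add: weight_def v_def)
  qed (use \<beta> r1 r2 in \<open>auto simp: r_def\<close>)
qed

lemma kernel_power_closed: "x \<in> S \<Longrightarrow> set_pmf (kernel_power P n x) \<subseteq> S"
  using closed by (induction n arbitrary: x) fastforce+

text \<open>This is the contraction read on test functions: a function with values in the unit
  interval varies by at most \<open>weight\<close> between two points, and each application of the
  kernel multiplies this Lipschitz constant by \<open>r\<close>.\<close>

lemma kernel_power_oscillation:
  obtains \<beta> r where "\<beta> > 0" "0 \<le> r" "r < 1"
    "\<And>(f :: 's \<Rightarrow> real) n x y. (\<And>u. 0 \<le> f u) \<Longrightarrow> (\<And>u. f u \<le> 1) \<Longrightarrow> x \<in> S \<Longrightarrow> y \<in> S \<Longrightarrow>
      \<bar>measure_pmf.expectation (kernel_power P n x) f - measure_pmf.expectation (kernel_power P n y) f\<bar>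
        \<le> r ^ n * weight \<beta> x y"
proof -
  obtain \<beta> r where r: "\<beta> > 0" "0 \<le> r" "r < 1"
    and contract: "\<And>x y. x \<in> S \<Longrightarrow> y \<in> S \<Longrightarrow> measure_pmf.expectation (pair_pmf (P x) (P y))
      (\<lambda>u. of_bool (fst u \<noteq> snd u) + \<beta> * (V (fst u) + V (snd u))) \<le> r * weight \<beta> x y"
    using independent_coupling_contracts by blast
  show thesis
  proof (rule that[OF r])
    fix f :: "'s \<Rightarrow> real" and n x y
    assume f: "\<And>u. 0 \<le> f u" "\<And>u. f u \<le> 1" and "x \<in> S" "y \<in> S"
    define g where "g n x = measure_pmf.expectation (kernel_power P n x) f" for n x
    have g: "0 \<le> g n x" "g n x \<le> 1" for n x
      unfolding g_def using f by (intro expectation_unit_interval; simp)+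
    have g_Suc: "g (Suc n) x = measure_pmf.expectation (P x) (g n)" for n x
      unfolding g_def[abs_def] using f
      by (simp add: expectation_bind_pmf_bounded[of f 1] abs_if order_trans[OF _ f(1)])
    have "\<bar>g n x - g n y\<bar> \<le> r ^ n * weight \<beta> x y"
      using \<open>x \<in> S\<close> \<open>y \<in> S\<close>
    proof (induction n arbitrary: x y)
      case (0 x y)
      have "\<bar>g 0 x - g 0 y\<bar> \<le> 1" using g[of 0 x] g[of 0 y] by auto
      also have "1 \<le> weight \<beta> x y" using r V_nonneg by (simp add: weight_def)
      finally show ?case by simp
    next
      case (Suc n x y)
      let ?M = "pair_pmf (P x) (P y)"
      let ?W = "\<lambda>u. of_bool (fst u \<noteq> snd u) + \<beta> * (V (fst u) + V (snd u))"
      have int: "integrable ?M (\<lambda>u. g n (fst u))" "integrable ?M (\<lambda>u. g n (snd u))"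
        using g by (auto intro!: expectation_unit_interval(1))
      have intW: "integrable ?M ?W"
        using integrable_pair_V[OF Suc.prems] expectation_unit_interval(1)[of "\<lambda>u. of_bool (fst u \<noteq> snd u)" ?M]
        by simp
      have "g (Suc n) x - g (Suc n) y = measure_pmf.expectation ?M (\<lambda>u. g n (fst u) - g n (snd u))"
        using int by (simp add: g_Suc)
      then have "\<bar>g (Suc n) x - g (Suc n) y\<bar> \<le> measure_pmf.expectation ?M (\<lambda>u. \<bar>g n (fst u) - g n (snd u)\<bar>)"
        by (simp add: integral_abs_bound)
      also have "\<dots> \<le> measure_pmf.expectation ?M (\<lambda>u. r ^ n * ?W u)"
      proof (rule integral_mono_AE)
        show "AE u in ?M. \<bar>g n (fst u) - g n (snd u)\<bar> \<le> r ^ n * ?W u"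
        proof (rule AE_pmfI)
          fix u assume "u \<in> set_pmf ?M"
          then have u: "fst u \<in> S" "snd u \<in> S" using closed[OF Suc.prems(1)] closed[OF Suc.prems(2)] by auto
          show "\<bar>g n (fst u) - g n (snd u)\<bar> \<le> r ^ n * ?W u"
            using Suc.IH[OF u] r V_nonneg by (cases "fst u = snd u") (auto simp: weight_def)
        qed
      qed (use int intW in auto)
      also have "\<dots> = r ^ n * measure_pmf.expectation ?M ?W" using intW by simp
      also have "\<dots> \<le> r ^ n * (r * weight \<beta> x y)"
        using contract Suc.prems r by (intro mult_left_mono) auto
      finally show ?case by (simp add: mult_ac)
    qed
    then show "\<bar>measure_pmf.expectation (kernel_power P n x) f - measure_pmf.expectation (kernel_power P n y) f\<bar>
        \<le> r ^ n * weight \<beta> x y"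
      by (simp add: g_def)
  qed
qed

lemma invariant_kernel_power: "bind_pmf \<mu> P = \<mu> \<Longrightarrow> bind_pmf \<mu> (kernel_power P n) = \<mu>"
proof (induction n)
  case 0
  have "kernel_power P 0 = return_pmf" by (simp add: fun_eq_iff)
  then show ?case by (simp add: bind_return_pmf')
next
  case (Suc n)
  have "kernel_power P (Suc n) = (\<lambda>x. bind_pmf (P x) (kernel_power P n))" by (simp add: fun_eq_iff)
  then show ?case using Suc by (simp flip: bind_assoc_pmf)
qed

text \<open>The oscillation bound is integrated over two independent starting points. Both invariant
  laws integrate \<open>V\<close>, so the integrated \<open>weight\<close> is a finite constant
  \<open>C\<close>, and \<open>r ^ n * C\<close> tends to 0.\<close>

theorem invariant_unique:
  assumes "set_pmf \<mu> \<subseteq> S" "bind_pmf \<mu> P = \<mu>" "set_pmf \<nu> \<subseteq> S" "bind_pmf \<nu> P = \<nu>"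
  shows "\<mu> = \<nu>"
proof (rule pmf_eqI)
  fix w
  obtain \<beta> r where r: "\<beta> > 0" "0 \<le> r" "r < 1"
    and osc: "\<And>(f :: 's \<Rightarrow> real) n x y. (\<And>u. 0 \<le> f u) \<Longrightarrow> (\<And>u. f u \<le> 1) \<Longrightarrow> x \<in> S \<Longrightarrow> y \<in> S \<Longrightarrow>
      \<bar>measure_pmf.expectation (kernel_power P n x) f - measure_pmf.expectation (kernel_power P n y) f\<bar>
        \<le> r ^ n * weight \<beta> x y"
    using kernel_power_oscillation by blast
  let ?M = "pair_pmf \<mu> \<nu>"
  have V: "integrable ?M (\<lambda>u. V (fst u))" "integrable ?M (\<lambda>u. V (snd u))"
    using integrable_map_pmf_eq[of fst ?M V] integrable_map_pmf_eq[of snd ?M V]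
      expectation_V_invariant(1) assms
    by (simp_all add: map_fst_pair_pmf map_snd_pair_pmf)
  define C where "C = measure_pmf.expectation ?M (\<lambda>u. weight \<beta> (fst u) (snd u))"
  have "\<bar>pmf \<mu> w - pmf \<nu> w\<bar> \<le> r ^ n * C" for n
  proof -
    define g where "g x = pmf (kernel_power P n x) w" for x
    have g_eq: "g x = measure_pmf.expectation (kernel_power P n x) (indicator {w})" for x
      by (simp add: g_def measure_pmf_single)
    have inv: "pmf \<pi> w = measure_pmf.expectation \<pi> g" if "bind_pmf \<pi> P = \<pi>" for \<pi>
      using invariant_kernel_power[OF that, of n] pmf_bind[of \<pi> "kernel_power P n" w]
      by (simp add: g_def[abs_def])
    have int: "integrable ?M (\<lambda>u. g (fst u))" "integrable ?M (\<lambda>u. g (snd u))"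
      by (auto intro!: expectation_unit_interval(1) simp: g_def pmf_le_1)
    have "pmf \<mu> w - pmf \<nu> w = measure_pmf.expectation ?M (\<lambda>u. g (fst u) - g (snd u))"
      using int inv assms by simp
    then have "\<bar>pmf \<mu> w - pmf \<nu> w\<bar> \<le> measure_pmf.expectation ?M (\<lambda>u. \<bar>g (fst u) - g (snd u)\<bar>)"
      by (simp add: integral_abs_bound)
    also have "\<dots> \<le> measure_pmf.expectation ?M (\<lambda>u. r ^ n * weight \<beta> (fst u) (snd u))"
    proof (rule integral_mono_AE)
      show "AE u in ?M. \<bar>g (fst u) - g (snd u)\<bar> \<le> r ^ n * weight \<beta> (fst u) (snd u)"
      proof (rule AE_pmfI)
        fix u assume "u \<in> set_pmf ?M"
        then have u: "fst u \<in> S" "snd u \<in> S" using assms by auto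
        show "\<bar>g (fst u) - g (snd u)\<bar> \<le> r ^ n * weight \<beta> (fst u) (snd u)"
          unfolding g_eq by (intro osc u) (auto simp: indicator_def)
      qed
    qed (use int V in \<open>auto simp: weight_def\<close>)
    finally show ?thesis by (simp add: C_def)
  qed
  moreover have "(\<lambda>n. r ^ n * C) \<longlonglongrightarrow> 0"
    using r by (intro tendsto_mult_left_zero LIMSEQ_realpow_zero) auto
  ultimately have "\<bar>pmf \<mu> w - pmf \<nu> w\<bar> \<le> 0"
    by (intro LIMSEQ_le_const) auto
  then show "pmf \<mu> w = pmf \<nu> w" by simp
qed

text \<open>The laws started at \<open>z\<close> are Cauchy against every test function with values
  in the unit interval, at a rate independent of the function. Their pointwise limit is a law
  because no mass escapes, and testing with \<open>pmf (P x) y\<close> passes the kernel to the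
  limit.\<close>

theorem invariant_exists: "\<exists>\<mu>. set_pmf \<mu> \<subseteq> S \<and> bind_pmf \<mu> P = \<mu>"
proof -
  obtain \<beta> r where r: "\<beta> > 0" "0 \<le> r" "r < 1"
    and osc: "\<And>(f :: 's \<Rightarrow> real) n x y. (\<And>u. 0 \<le> f u) \<Longrightarrow> (\<And>u. f u \<le> 1) \<Longrightarrow> x \<in> S \<Longrightarrow> y \<in> S \<Longrightarrow>
      \<bar>measure_pmf.expectation (kernel_power P n x) f - measure_pmf.expectation (kernel_power P n y) f\<bar>
        \<le> r ^ n * weight \<beta> x y"
    using kernel_power_oscillation by blast
  define \<nu> where "\<nu> n = kernel_power P n z" for n
  have \<nu>_Suc: "\<nu> (Suc n) = bind_pmf (\<nu> n) P" for n
  proof -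
    have zero: "kernel_power P 0 = return_pmf" by (simp add: fun_eq_iff)
    have "kernel_power P (Suc 0) x = P x" for x
      unfolding kernel_power.simps(2) zero by (rule bind_return_pmf')
    then have "kernel_power P (Suc 0) = P" by blast
    then show ?thesis using kernel_power_add[of P n "Suc 0" z] by (simp add: \<nu>_def)
  qed
  define C where "C = measure_pmf.expectation (P z) (\<lambda>x. weight \<beta> x z)"
  have C: "C \<ge> 0"
    unfolding C_def using r V_nonneg by (intro integral_nonneg_AE AE_pmfI) (auto simp: weight_def)
  have step: "\<bar>measure_pmf.expectation (\<nu> (Suc n)) f - measure_pmf.expectation (\<nu> n) f\<bar> \<le> r ^ n * C"
    if f: "\<And>u. 0 \<le> f u" "\<And>u. f u \<le> 1" for f :: "'s \<Rightarrow> real" and n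
  proof -
    define g where "g x = measure_pmf.expectation (kernel_power P n x) f" for x
    have g: "0 \<le> g x" "g x \<le> 1" for x
      unfolding g_def using f by (intro expectation_unit_interval; simp)+
    have "\<bar>f u\<bar> \<le> 1" for u using f[of u] by auto
    then have "measure_pmf.expectation (\<nu> (Suc n)) f = measure_pmf.expectation (P z) g"
      by (simp add: \<nu>_def g_def[abs_def] expectation_bind_pmf_bounded[of f 1])
    moreover have "measure_pmf.expectation (\<nu> n) f = g z" by (simp add: \<nu>_def g_def)
    ultimately have "measure_pmf.expectation (\<nu> (Suc n)) f - measure_pmf.expectation (\<nu> n) f =
        measure_pmf.expectation (P z) (\<lambda>x. g x - g z)"
      using expectation_unit_interval(1)[of g "P z"] g by simp
    then have "\<bar>measure_pmf.expectation (\<nu> (Suc n)) f - measure_pmf.expectation (\<nu> n) f\<bar>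
        \<le> measure_pmf.expectation (P z) (\<lambda>x. \<bar>g x - g z\<bar>)"
      by (simp add: integral_abs_bound)
    also have "\<dots> \<le> measure_pmf.expectation (P z) (\<lambda>x. r ^ n * weight \<beta> x z)"
    proof (rule integral_mono_AE)
      show "AE x in P z. \<bar>g x - g z\<bar> \<le> r ^ n * weight \<beta> x z"
        unfolding g_def using closed[OF atom(1)] f
        by (intro AE_pmfI osc atom(1)) auto
    qed (use g expectation_unit_interval(1)[of g "P z"] V_integrable[OF atom(1)] in \<open>auto simp: weight_def\<close>)
    finally show ?thesis by (simp add: C_def)
  qed
  \<comment> \<open>Sum of the geometric series of the one-step bounds
    \<open>r ^ n * C\<close>.\<close>
  define C' where "C' = C / (1 - r)"
  have shift: "\<bar>measure_pmf.expectation (\<nu> (m + k)) f - measure_pmf.expectation (\<nu> m) f\<bar> \<le> r ^ m * C'"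
    if f: "\<And>u. 0 \<le> f u" "\<And>u. f u \<le> 1" for f :: "'s \<Rightarrow> real" and m k
  proof -
    have "\<bar>measure_pmf.expectation (\<nu> (m + k)) f - measure_pmf.expectation (\<nu> m) f\<bar>
        \<le> r ^ m * (C' * (1 - r ^ k))"
    proof (induction k)
      case (Suc k)
      have "r ^ (m + k) * C + r ^ m * (C' * (1 - r ^ k)) = r ^ m * (C' * (1 - r ^ Suc k))"
        using r by (simp add: C'_def field_simps power_add)
      moreover have "\<bar>measure_pmf.expectation (\<nu> (m + Suc k)) f - measure_pmf.expectation (\<nu> (m + k)) f\<bar>
          \<le> r ^ (m + k) * C"
        using step[of f "m + k", OF f] by simp
      ultimately show ?case using Suc by linarith
    qed simp
    also have "\<dots> \<le> r ^ m * (C' * 1)"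
      using r C by (intro mult_left_mono) (auto simp: C'_def)
    finally show ?thesis by simp
  qed
  have rC: "(\<lambda>m. r ^ m * C') \<longlonglongrightarrow> 0"
    using r by (intro tendsto_mult_left_zero LIMSEQ_realpow_zero) auto
  have conv: "convergent (\<lambda>n. measure_pmf.expectation (\<nu> n) f)"
    if f: "\<And>u. 0 \<le> f u" "\<And>u. f u \<le> 1" for f :: "'s \<Rightarrow> real"
  proof (rule Cauchy_convergent, rule CauchyI)
    fix e :: real assume "e > 0"
    then have "\<forall>\<^sub>F m in sequentially. r ^ m * C' < e / 2"
      using rC by (intro order_tendstoD) auto
    then obtain m where m: "r ^ m * C' < e / 2"
      by (meson eventually_sequentially order_refl)
    have "\<bar>measure_pmf.expectation (\<nu> n) f - measure_pmf.expectation (\<nu> m) f\<bar> < e / 2" if "n \<ge> m" for n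
      using shift[of f m "n - m", OF f] m that by simp
    then have "\<bar>measure_pmf.expectation (\<nu> n) f - measure_pmf.expectation (\<nu> k) f\<bar> < e"
      if "n \<ge> m" "k \<ge> m" for n k
      using that by (smt (verit) field_sum_of_halves)
    then show "\<exists>M. \<forall>n\<ge>M. \<forall>k\<ge>M. norm (measure_pmf.expectation (\<nu> n) f - measure_pmf.expectation (\<nu> k) f) < e"
      by auto
  qed
  define G where "G y = lim (\<lambda>n. pmf (\<nu> n) y)" for y
  have lim: "(\<lambda>n. pmf (\<nu> n) y) \<longlonglongrightarrow> G y" for y
    using conv[of "indicator {y}"] unfolding G_def
    by (auto simp: measure_pmf_single indicator_def convergent_LIMSEQ_iff)
  have G: "G y \<ge> 0" for y
    using lim[of y] by (intro LIMSEQ_le_const) auto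
  \<comment> \<open>The bound in \<open>shift\<close> is uniform in the test function, so a finite
    set carrying almost all of a single law \<open>\<nu> m\<close> does so for all later
    laws.\<close>
  have tight: "\<exists>F. finite F \<and> (\<forall>\<^sub>F n in sequentially. measure_pmf.prob (\<nu> n) F \<ge> 1 - e)" if "e > 0" for e
  proof -
    have "\<forall>\<^sub>F m in sequentially. r ^ m * C' < e / 2"
      using rC that by (intro order_tendstoD) auto
    then obtain m where m: "r ^ m * C' < e / 2"
      by (meson eventually_sequentially order_refl)
    obtain F where F: "finite F" "measure_pmf.prob (\<nu> m) F > 1 - e / 2"
      using finite_approximation_pmf[of "e / 2" "\<nu> m"] \<open>e > 0\<close> by auto
    have "measure_pmf.prob (\<nu> n) F \<ge> 1 - e" if "n \<ge> m" for n
      using shift[of "indicator F" m "n - m"] m F that by (simp add: indicator_def) 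
    then show ?thesis using F(1) by (auto simp: eventually_sequentially)
  qed
  have sum_G: "1 - e \<le> (\<Sum>y\<in>F. G y)"
    if "finite F" "\<forall>\<^sub>F n in sequentially. measure_pmf.prob (\<nu> n) F \<ge> 1 - e" for e F
  proof (rule tendsto_lowerbound)
    show "(\<lambda>n. measure_pmf.prob (\<nu> n) F) \<longlonglongrightarrow> (\<Sum>y\<in>F. G y)"
      using that(1) by (simp add: measure_measure_pmf_finite) (intro tendsto_intros lim)
  qed (use that in auto)
  \<comment> \<open>Fatou's lemma gives the upper bound, tightness the lower one.\<close>
  have total: "(\<integral>\<^sup>+ y. ennreal (G y) \<partial>count_space UNIV) = 1"
  proof (rule antisym)
    have "(\<integral>\<^sup>+ y. ennreal (G y) \<partial>count_space UNIV) =
        (\<integral>\<^sup>+ y. liminf (\<lambda>n. ennreal (pmf (\<nu> n) y)) \<partial>count_space UNIV)"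
      using lim by (intro nn_integral_cong lim_imp_Liminf[symmetric] tendsto_ennrealI) auto
    also have "\<dots> \<le> liminf (\<lambda>n. \<integral>\<^sup>+ y. ennreal (pmf (\<nu> n) y) \<partial>count_space UNIV)"
      by (intro nn_integral_liminf) simp
    also have "\<dots> = 1" by (simp add: nn_integral_pmf measure_pmf.emeasure_space_1[simplified] Liminf_const)
    finally show "(\<integral>\<^sup>+ y. ennreal (G y) \<partial>count_space UNIV) \<le> 1" .
    show "1 \<le> (\<integral>\<^sup>+ y. ennreal (G y) \<partial>count_space UNIV)"
    proof (rule ennreal_le_epsilon)
      fix e :: real assume "e > 0"
      then obtain F where F: "finite F" "\<forall>\<^sub>F n in sequentially. measure_pmf.prob (\<nu> n) F \<ge> 1 - e"
        using tight by blast
      have "ennreal 1 \<le> ennreal ((\<Sum>y\<in>F. G y) + e)"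
        using sum_G[OF F] by (intro ennreal_leI) simp
      also have "\<dots> = (\<Sum>y\<in>F. ennreal (G y)) + ennreal e"
        using G \<open>e > 0\<close> by (simp add: ennreal_plus sum_nonneg sum_ennreal)
      also have "(\<Sum>y\<in>F. ennreal (G y)) = (\<integral>\<^sup>+ y. ennreal (G y) * indicator F y \<partial>count_space UNIV)"
        using F(1) by (simp add: nn_integral_count_space_indicator[symmetric] nn_integral_count_space_finite)
      also have "\<dots> \<le> (\<integral>\<^sup>+ y. ennreal (G y) \<partial>count_space UNIV)"
        by (intro nn_integral_mono) (auto simp: indicator_def)
      finally show "1 \<le> (\<integral>\<^sup>+ y. ennreal (G y) \<partial>count_space UNIV) + ennreal e"
        by (simp add: add_right_mono)
    qed
  qed
  define \<mu> where "\<mu> = embed_pmf G"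
  have \<mu>: "pmf \<mu> y = G y" for y
    unfolding \<mu>_def using G total by (intro pmf_embed_pmf) auto
  have "set_pmf \<mu> \<subseteq> S"
  proof
    fix y assume "y \<in> set_pmf \<mu>"
    then have "G y \<noteq> 0" by (simp add: \<mu> set_pmf_iff)
    have "\<exists>n. pmf (\<nu> n) y \<noteq> 0"
    proof (rule ccontr)
      assume "\<nexists>n. pmf (\<nu> n) y \<noteq> 0"
      then have "(\<lambda>n. 0) \<longlonglongrightarrow> G y" using lim[of y] by simp
      then show False using \<open>G y \<noteq> 0\<close> by (simp add: LIMSEQ_const_iff)
    qed
    then obtain n where "pmf (\<nu> n) y \<noteq> 0" by blast
    then have "y \<in> set_pmf (\<nu> n)" by (simp add: set_pmf_iff)
    then show "y \<in> S" using kernel_power_closed[OF atom(1), of n] by (auto simp: \<nu>_def)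
  qed
  have weak: "(\<lambda>n. measure_pmf.expectation (\<nu> n) g) \<longlonglongrightarrow> measure_pmf.expectation \<mu> g"
    if g: "\<And>u. 0 \<le> g u" "\<And>u. g u \<le> 1" for g :: "'s \<Rightarrow> real"
  proof -
    obtain l where l: "(\<lambda>n. measure_pmf.expectation (\<nu> n) g) \<longlonglongrightarrow> l"
      using conv[of g, OF g] by (auto simp: convergent_def)
    have "\<bar>l - measure_pmf.expectation \<mu> g\<bar> \<le> 2 * e" if e: "e > 0" for e
    proof -
      obtain F where F: "finite F" "\<forall>\<^sub>F n in sequentially. measure_pmf.prob (\<nu> n) F \<ge> 1 - e"
        using tight[OF e] by blast
      have "\<bar>l - (\<Sum>y\<in>F. G y * g y)\<bar> \<le> e"
      proof (rule tendsto_upperbound)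
        show "(\<lambda>n. \<bar>measure_pmf.expectation (\<nu> n) g - (\<Sum>y\<in>F. pmf (\<nu> n) y * g y)\<bar>)
            \<longlonglongrightarrow> \<bar>l - (\<Sum>y\<in>F. G y * g y)\<bar>"
          by (intro tendsto_intros l lim)
        show "\<forall>\<^sub>F n in sequentially. \<bar>measure_pmf.expectation (\<nu> n) g - (\<Sum>y\<in>F. pmf (\<nu> n) y * g y)\<bar> \<le> e"
          using F(2)
        proof eventually_elim
          case (elim n)
          then show ?case
            using expectation_finite_part[of F g "\<nu> n", OF F(1) g] F(1)
            by (simp add: measure_measure_pmf_finite)
        qed
      qed simp
      moreover have "\<bar>measure_pmf.expectation \<mu> g - (\<Sum>y\<in>F. G y * g y)\<bar> \<le> e"
        using expectation_finite_part[of F g \<mu>, OF F(1) g] sum_G[OF F] by (simp add: \<mu>)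
      ultimately show ?thesis by linarith
    qed
    then have "\<bar>l - measure_pmf.expectation \<mu> g\<bar> \<le> 0 + e" if "e > 0" for e
      using that by (metis add_0 field_sum_of_halves half_gt_zero mult_2)
    then have "\<bar>l - measure_pmf.expectation \<mu> g\<bar> \<le> 0"
      by (rule field_le_epsilon)
    then have "l = measure_pmf.expectation \<mu> g" by simp
    then show ?thesis using l by simp
  qed
  have "bind_pmf \<mu> P = \<mu>"
  proof (rule pmf_eqI)
    fix y
    have "(\<lambda>n. measure_pmf.expectation (\<nu> n) (\<lambda>x. pmf (P x) y)) \<longlonglongrightarrow> pmf (bind_pmf \<mu> P) y"
      unfolding pmf_bind by (intro weak) (auto simp: pmf_le_1)
    moreover have "measure_pmf.expectation (\<nu> n) (\<lambda>x. pmf (P x) y) = pmf (\<nu> (Suc n)) y" for n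
      by (simp add: \<nu>_Suc pmf_bind)
    ultimately have "(\<lambda>n. pmf (\<nu> (Suc n)) y) \<longlonglongrightarrow> pmf (bind_pmf \<mu> P) y" by simp
    moreover have "(\<lambda>n. pmf (\<nu> (Suc n)) y) \<longlonglongrightarrow> G y"
      using lim by (rule LIMSEQ_Suc)
    ultimately show "pmf (bind_pmf \<mu> P) y = pmf \<mu> y"
      unfolding \<mu> by (rule LIMSEQ_unique)
  qed
  with \<open>set_pmf \<mu> \<subseteq> S\<close> show ?thesis by blast
qed

end

section \<open>Passing to real expectations and to smaller exponents\<close>

lemma expectation_le_of_nn_integral_le:
  fixes f :: "'a \<Rightarrow> real"
  assumes "\<And>x. 0 \<le> f x" "(\<integral>\<^sup>+ x. ennreal (f x) \<partial>measure_pmf M) \<le> ennreal c" "0 \<le> c"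
  shows "integrable (measure_pmf M) f" "measure_pmf.expectation M f \<le> c"
proof -
  show int: "integrable (measure_pmf M) f"
    using assms by (intro integrableI_nonneg) (auto intro: le_less_trans)
  show "measure_pmf.expectation M f \<le> c"
    using assms by (subst (asm) nn_integral_eq_integral[OF int]) (auto simp: ennreal_le_iff)
qed

text \<open>Jensen's inequality for the concave power \<open>\<theta>\<close>, obtained from the
  convexity bound \<open>exp (\<theta> * y) \<le> 1 - \<theta> + \<theta> * exp y\<close> at
  \<open>y = Y x - c\<close>. Normalising by \<open>exp c\<close> instead of the exact expectation
  lets \<open>c\<close> come from any upper bound.\<close>

lemma expectation_exp_interpolation:
  fixes Y :: "'a \<Rightarrow> real"
  assumes int: "integrable (measure_pmf M) (\<lambda>x. exp (Y x))"
    and le: "measure_pmf.expectation M (\<lambda>x. exp (Y x)) \<le> exp c"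
    and \<theta>: "0 \<le> \<theta>" "\<theta> \<le> 1"
  shows "integrable (measure_pmf M) (\<lambda>x. exp (\<theta> * Y x))"
    "measure_pmf.expectation M (\<lambda>x. exp (\<theta> * Y x)) \<le> exp (\<theta> * c)"
proof -
  define g where "g x = exp (\<theta> * c) * (1 - \<theta> + \<theta> * exp (- c) * exp (Y x))" for x
  have le_g: "exp (\<theta> * Y x) \<le> g x" for x
  proof -
    have "exp ((1 - \<theta>) *\<^sub>R 0 + \<theta> *\<^sub>R (Y x - c)) \<le> (1 - \<theta>) * exp 0 + \<theta> * exp (Y x - c)"
      using \<theta> by (intro convex_onD[OF exp_convex]) auto
    then have "exp (\<theta> * c) * exp (\<theta> * (Y x - c)) \<le> exp (\<theta> * c) * ((1 - \<theta>) + \<theta> * exp (Y x - c))"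
      by (intro mult_left_mono) auto
    moreover have "exp (\<theta> * c) * exp (\<theta> * (Y x - c)) = exp (\<theta> * Y x)"
      by (simp add: algebra_simps flip: exp_add)
    moreover have "exp (Y x - c) = exp (- c) * exp (Y x)"
      by (simp flip: exp_add)
    ultimately show ?thesis by (simp add: g_def mult.assoc)
  qed
  have int_g: "integrable (measure_pmf M) g"
    unfolding g_def[abs_def] using int by simp
  show int': "integrable (measure_pmf M) (\<lambda>x. exp (\<theta> * Y x))"
    using le_g by (intro Bochner_Integration.integrable_bound[OF int_g])
      (auto intro!: AE_I2 order_trans[OF le_g])
  have "measure_pmf.expectation M (\<lambda>x. exp (\<theta> * Y x)) \<le> measure_pmf.expectation M g"
    using le_g int_g int' by (intro integral_mono) auto
  also have "\<dots> = exp (\<theta> * c) * (1 - \<theta> + \<theta> * exp (- c) * measure_pmf.expectation M (\<lambda>x. exp (Y x)))"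
    unfolding g_def[abs_def] using int by simp
  also have "\<dots> \<le> exp (\<theta> * c) * (1 - \<theta> + \<theta> * exp (- c) * exp c)"
    using \<theta> le by (intro mult_left_mono add_left_mono) auto
  also have "\<dots> = exp (\<theta> * c)"
    by (simp add: mult.assoc flip: exp_add)
  finally show "measure_pmf.expectation M (\<lambda>x. exp (\<theta> * Y x)) \<le> exp (\<theta> * c)" .
qed

lemma nn_integral_kernel_power_Suc:
  "(\<integral>\<^sup>+ \<eta>. g \<eta> \<partial>measure_pmf (kernel_power K (Suc n) x)) =
    (\<integral>\<^sup>+ y. (\<integral>\<^sup>+ \<eta>. g \<eta> \<partial>measure_pmf (kernel_power K n y)) \<partial>measure_pmf (K x))"
  by (simp add: nn_integral_bind_pmf)

section \<open>Exponential mass of the Fleming-Viot walks\<close>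

locale fleming_viot_walks =
  fixes p q :: real and N :: nat
  assumes p_pos: "p > 0" and q_pos: "q > 0" and q_eq: "q = 1 - p" and drift: "q > p"
    and N_ge: "N \<ge> 2"
begin

text \<open>The arguments \<open>u i\<close>, \<open>d i\<close> and \<open>c i j\<close> belong to walk \<open>i\<close> moving up, moving down, and being
  killed and put at the position of walk \<open>j\<close>. They need not be functions of the new configuration,
  as they also depend on the tracked set.\<close>

definition move_average ::
    "nat list \<Rightarrow> (nat \<Rightarrow> real) \<Rightarrow> (nat \<Rightarrow> real) \<Rightarrow> (nat \<Rightarrow> nat \<Rightarrow> real) \<Rightarrow> real" where
  "move_average \<xi> u d c =
     (\<Sum>i<N. p * u i + q * (if \<xi> ! i = 1 then (\<Sum>j\<in>{..<N} - {i}. c i j) / (real N - 1) else d i))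
       / real N"

lemma move_average_linear:
  "move_average \<xi> (\<lambda>i. x * u i + y * u' i) (\<lambda>i. x * d i + y * d' i) (\<lambda>i j. x * c i j + y * c' i j) =
    x * move_average \<xi> u d c + y * move_average \<xi> u' d' c'"
proof -
  have lin: "p * (x * u i + y * u' i) + q * (if \<xi> ! i = 1
      then (\<Sum>j\<in>{..<N} - {i}. x * c i j + y * c' i j) / (real N - 1) else x * d i + y * d' i) =
    x * (p * u i + q * (if \<xi> ! i = 1 then (\<Sum>j\<in>{..<N} - {i}. c i j) / (real N - 1) else d i)) +
    y * (p * u' i + q * (if \<xi> ! i = 1 then (\<Sum>j\<in>{..<N} - {i}. c' i j) / (real N - 1) else d' i))" for i
    by (simp add: sum.distrib add_divide_distrib algebra_simps flip: sum_distrib_left)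
  have avg: "(\<Sum>i<N. x * e i + y * e' i) / real N =
      x * ((\<Sum>i<N. e i) / real N) + y * ((\<Sum>i<N. e' i) / real N)" for e e'
    by (simp add: sum.distrib add_divide_distrib flip: sum_distrib_left)
  show ?thesis
    unfolding move_average_def lin by (rule avg)
qed

text \<open>\<open>g\<close> is extended-valued because it will be the integral after
  \<open>n\<close> further jumps, whose finiteness comes out of the very inductions that use this
  bound.\<close>

lemma nn_integral_fv_step_le:
  fixes g :: "nat list \<Rightarrow> ennreal"
  assumes nonneg: "\<And>i. 0 \<le> u i" "\<And>i. 0 \<le> d i" "\<And>i j. 0 \<le> c i j"
    and u: "\<And>i. i < N \<Longrightarrow> g (\<xi>[i := \<xi> ! i + 1]) \<le> ennreal (u i)"
    and d: "\<And>i. i < N \<Longrightarrow> \<xi> ! i \<noteq> 1 \<Longrightarrow> g (\<xi>[i := \<xi> ! i - 1]) \<le> ennreal (d i)"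
    and c: "\<And>i j. i < N \<Longrightarrow> \<xi> ! i = 1 \<Longrightarrow> j < N \<Longrightarrow> j \<noteq> i \<Longrightarrow> g (\<xi>[i := \<xi> ! j]) \<le> ennreal (c i j)"
  shows "(\<integral>\<^sup>+ \<eta>. g \<eta> \<partial>measure_pmf (fv_step p N \<xi>)) \<le> ennreal (move_average \<xi> u d c)"
proof -
  have N: "{..<N} \<noteq> {}" "real N > 0" "real N - 1 > 0"
    using N_ge by (auto simp: lessThan_empty_iff)
  have copy: "(\<integral>\<^sup>+ \<eta>. g \<eta> \<partial>measure_pmf (map_pmf (\<lambda>j. \<xi>[i := \<xi> ! j]) (pmf_of_set ({..<N} - {i}))))
      \<le> ennreal ((\<Sum>j\<in>{..<N} - {i}. c i j) / (real N - 1))" if "i < N" "\<xi> ! i = 1" for i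
  proof -
    have card: "real (card ({..<N} - {i})) = real N - 1"
      using that N_ge by (simp add: of_nat_diff)
    have "(\<integral>\<^sup>+ \<eta>. g \<eta> \<partial>measure_pmf (map_pmf (\<lambda>j. \<xi>[i := \<xi> ! j]) (pmf_of_set ({..<N} - {i})))) =
        (\<Sum>j\<in>{..<N} - {i}. g (\<xi>[i := \<xi> ! j])) / ennreal (real N - 1)"
      using others_nonempty[OF N_ge, of i]
      by (simp add: nn_integral_pmf_of_set ennreal_of_nat_eq_real_of_nat flip: card)
    also have "\<dots> \<le> (\<Sum>j\<in>{..<N} - {i}. ennreal (c i j)) / ennreal (real N - 1)"
      using that c by (intro divide_right_mono_ennreal sum_mono) auto
    also have "\<dots> = ennreal ((\<Sum>j\<in>{..<N} - {i}. c i j) / (real N - 1))"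
      using nonneg N by (simp add: sum_ennreal divide_ennreal sum_nonneg)
    finally show ?thesis .
  qed
  have "(\<integral>\<^sup>+ \<eta>. g \<eta> \<partial>measure_pmf (fv_step p N \<xi>)) =
      (\<Sum>i<N. ennreal p * g (\<xi>[i := \<xi> ! i + 1]) + ennreal q *
        (\<integral>\<^sup>+ \<eta>. g \<eta> \<partial>measure_pmf (if \<xi> ! i = 1 then map_pmf (\<lambda>j. \<xi>[i := \<xi> ! j]) (pmf_of_set ({..<N} - {i}))
          else return_pmf (\<xi>[i := \<xi> ! i - 1])))) / ennreal (real N)"
    using N p_pos q_pos q_eq
    by (simp add: fv_step_def nn_integral_bind_pmf nn_integral_pmf_of_set mult.commute 
        flip: ennreal_of_nat_eq_real_of_nat)
  also have "\<dots> \<le> (\<Sum>i<N. ennreal (p * u i + q *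
        (if \<xi> ! i = 1 then (\<Sum>j\<in>{..<N} - {i}. c i j) / (real N - 1) else d i))) / ennreal (real N)"
  proof (intro divide_right_mono_ennreal sum_mono)
    fix i assume "i \<in> {..<N}"
    then have i: "i < N" by simp
    have nn: "0 \<le> (if \<xi> ! i = 1 then (\<Sum>j\<in>{..<N} - {i}. c i j) / (real N - 1) else d i)"
      using nonneg N by (auto intro!: divide_nonneg_nonneg sum_nonneg)
    have "(\<integral>\<^sup>+ \<eta>. g \<eta> \<partial>measure_pmf (if \<xi> ! i = 1 then map_pmf (\<lambda>j. \<xi>[i := \<xi> ! j]) (pmf_of_set ({..<N} - {i}))
          else return_pmf (\<xi>[i := \<xi> ! i - 1]))) \<le> 
        ennreal (if \<xi> ! i = 1 then (\<Sum>j\<in>{..<N} - {i}. c i j) / (real N - 1) else d i)"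
      using copy[OF i] d[OF i] by (cases "\<xi> ! i = 1") simp_all
    then show "ennreal p * g (\<xi>[i := \<xi> ! i + 1]) + ennreal q *
        (\<integral>\<^sup>+ \<eta>. g \<eta> \<partial>measure_pmf (if \<xi> ! i = 1 then map_pmf (\<lambda>j. \<xi>[i := \<xi> ! j]) (pmf_of_set ({..<N} - {i}))
          else return_pmf (\<xi>[i := \<xi> ! i - 1])))
        \<le> ennreal (p * u i + q *
        (if \<xi> ! i = 1 then (\<Sum>j\<in>{..<N} - {i}. c i j) / (real N - 1) else d i))"
      using u[OF i] nn nonneg p_pos q_pos
      by (simp add: ennreal_plus ennreal_mult add_mono mult_left_mono del: ennreal_plus[symmetric] split del: if_split)
  qed
  also have "\<dots> = ennreal (move_average \<xi> u d c)"
  proof -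
    have "0 \<le> p * u i + q *
        (if \<xi> ! i = 1 then (\<Sum>j\<in>{..<N} - {i}. c i j) / (real N - 1) else d i)" for i
      using nonneg N p_pos q_pos by (intro add_nonneg_nonneg mult_nonneg_nonneg)
        (auto intro!: divide_nonneg_nonneg sum_nonneg)
    then show ?thesis
      unfolding move_average_def using N
      by (simp only: sum_ennreal divide_ennreal sum_nonneg)
  qed
  finally show ?thesis .
qed

text \<open>Any base in the open interval from 1 to \<open>q / p\<close> would do. With this one \<open>p * base = 1 / 2\<close> and
  \<open>- gap\<close> is the growth rate of \<open>base\<close> to the power of the position of a free walk.\<close>

definition base :: real where "base = 1 / (2 * p)"

definition gap :: real where "gap = 1 / 2 - 2 * p * q"

definition mass :: "nat list \<Rightarrow> real" where "mass \<xi> = (\<Sum>i<N. base ^ (\<xi> ! i))"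

text \<open>For \<open>\<theta> = 1 / 2\<close> a tracked walk at site 1 contributes
  \<open>1 / 2\<close>, while one at height \<open>m\<close> contributes only
  \<open>(1 / 2) ^ m\<close>. A bound on its growth is thus a Markov-type bound on reaching site
  1.\<close>

definition depth :: "real \<Rightarrow> nat set \<Rightarrow> nat list \<Rightarrow> real" where
  "depth \<theta> D \<xi> = (\<Sum>i\<in>D. \<theta> ^ (\<xi> ! i))"

text \<open>Walk \<open>i\<close> is not removed when it is put at an untracked walk: it is killed at site 1, and once a
  tracked walk reaches site 1 tracking is given up anyway.\<close>

definition copied :: "nat set \<Rightarrow> nat \<Rightarrow> nat \<Rightarrow> nat set" where
  "copied D i j = (if j \<in> D then insert i D else D)"

lemma base_gt_1: "base > 1"
  using p_pos q_eq drift by (simp add: base_def)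

lemma gap_pos: "gap > 0" "gap \<le> 1 / 2"
proof -
  have "0 < (q - p)\<^sup>2"
    using drift by simp
  also have "(q - p)\<^sup>2 = 2 * gap"
    unfolding gap_def by (simp add: q_eq power2_eq_square algebra_simps)
  finally show "gap > 0" by simp
  show "gap \<le> 1 / 2"
    using p_pos q_pos by (simp add: gap_def)
qed

lemma gap_eq: "p * (base - 1) - q * (1 - 1 / base) = - gap"
  unfolding gap_def base_def using p_pos by (simp add: q_eq field_simps)

lemma mass_pos: "mass \<xi> > 0"
  using base_gt_1 N_ge unfolding mass_def by (intro sum_pos) (auto simp: lessThan_empty_iff)

section \<open>Effect of a single move on mass and depth\<close>

lemma mass_update:
  assumes "length \<xi> = N" "i < N"
  shows "mass (\<xi>[i := a]) = mass \<xi> + (base ^ a - base ^ (\<xi> ! i))"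
proof -
  have "mass (\<xi>[i := a]) = (\<Sum>k\<in>{..<N} - {i}. base ^ (\<xi> ! k)) + base ^ a"
    unfolding mass_def using assms by (subst sum.remove[of _ i]) (auto intro!: sum.cong)
  moreover have "mass \<xi> = (\<Sum>k\<in>{..<N} - {i}. base ^ (\<xi> ! k)) + base ^ (\<xi> ! i)"
    unfolding mass_def using assms by (subst sum.remove[of _ i]) auto
  ultimately show ?thesis by simp
qed

text \<open>The concave square root lies below its tangent at \<open>mass \<xi>\<close>. The bound
  is linear in the change of mass, so averages over moves can be summed walk by walk.\<close>

lemma sqrt_mass_update:
  assumes "length \<xi> = N" "i < N"
  shows "sqrt (mass (\<xi>[i := a])) \<le>
    sqrt (mass \<xi>) + (base ^ a - base ^ (\<xi> ! i)) / (2 * sqrt (mass \<xi>))"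
proof -
  define s t where "s = sqrt (mass \<xi>)" and "t = sqrt (mass (\<xi>[i := a]))"
  have s: "s > 0" "s\<^sup>2 = mass \<xi>" "t\<^sup>2 = mass (\<xi>[i := a])"
    using mass_pos less_imp_le[OF mass_pos] by (auto simp: s_def t_def)
  have "0 \<le> (t - s)\<^sup>2" by simp
  then have "2 * s * t \<le> 2 * s\<^sup>2 + (t\<^sup>2 - s\<^sup>2)"
    by (simp add: power2_eq_square algebra_simps)
  then have "t \<le> s + (t\<^sup>2 - s\<^sup>2) / (2 * s)"
    using s by (simp add: field_simps power2_eq_square)
  also have "t\<^sup>2 - s\<^sup>2 = base ^ a - base ^ (\<xi> ! i)"
    using s mass_update[OF assms] by simp
  finally show ?thesis by (simp add: s_def t_def)
qed

lemma configs_nth: "\<xi> \<in> configs N \<Longrightarrow> i < N \<Longrightarrow> 1 \<le> \<xi> ! i"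
  by (auto simp: configs_def)

lemma configs_length: "\<xi> \<in> configs N \<Longrightarrow> length \<xi> = N"
  by (simp add: configs_def)

lemma depth_update:
  assumes "length \<xi> = N" "i < N" "D \<subseteq> {..<N}"
  shows "depth \<theta> D (\<xi>[i := a]) = depth \<theta> D \<xi> + (if i \<in> D then \<theta> ^ a - \<theta> ^ (\<xi> ! i) else 0)"
proof -
  have fin: "finite D" using assms finite_subset by blast
  have rest: "(\<Sum>k\<in>D - {i}. \<theta> ^ (\<xi>[i := a] ! k)) = (\<Sum>k\<in>D - {i}. \<theta> ^ (\<xi> ! k))"
    by (intro sum.cong) auto
  show ?thesis
  proof (cases "i \<in> D")
    case True
    then show ?thesis
      using rest assms fin by (simp add: depth_def sum.remove[of D i])
  next
    case False
    then show ?thesis using rest by (simp add: depth_def)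
  qed
qed

lemma depth_nonneg: "\<theta> \<ge> 0 \<Longrightarrow> depth \<theta> D \<xi> \<ge> 0"
  by (simp add: depth_def sum_nonneg)

text \<open>The gain of \<open>sqrt f\<close> from a copy is on average at most \<open>sqrt f / (2 * (N - 1))\<close>, the loss of
  \<open>sqrt f / card D\<close> from enlarging \<open>D\<close> at least as much, because \<open>z / (z + 1) \<ge> 1 / 2\<close>.\<close>

lemma move_average_sqrt_mass_le:
  assumes \<xi>: "\<xi> \<in> configs N" and D: "D \<noteq> {}" "D \<subseteq> {..<N}" "\<And>i. i \<in> D \<Longrightarrow> \<xi> ! i \<noteq> 1"
  shows "move_average \<xi> (\<lambda>i. sqrt (mass (\<xi>[i := \<xi> ! i + 1])) / real (card D))
      (\<lambda>i. sqrt (mass (\<xi>[i := \<xi> ! i - 1])) / real (card D))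
      (\<lambda>i j. sqrt (mass (\<xi>[i := \<xi> ! j])) / real (card (copied D i j)))
    \<le> (1 - gap / (2 * real N)) * (sqrt (mass \<xi>) / real (card D))"
proof -
  define s z where "s = sqrt (mass \<xi>)" and "z = real (card D)"
  \<comment> \<open>\<open>e i\<close> bounds the effect of a free step down. The claim
    \<open>copy\<close> below shows that a kill at site 1, averaged over the copied walk, obeys the
    same bound, so the final average is that of free walks.\<close>
  define e where "e i = (s - (1 - 1 / base) * base ^ (\<xi> ! i) / (2 * s)) / z" for i
  have fin: "finite D" using D finite_subset by blast
  have s: "s > 0" "s * s = mass \<xi>"
    using mass_pos less_imp_le[OF mass_pos] by (auto simp: s_def)
  have z: "z \<ge> 1" using D fin by (simp add: z_def Suc_le_eq card_gt_0_iff)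
  have N: "real N \<ge> 2" using N_ge by simp
  note upd = sqrt_mass_update[OF configs_length[OF \<xi>], folded s_def]
  have b: "base > 1" "base > 0" using base_gt_1 by auto
  have up: "sqrt (mass (\<xi>[i := \<xi> ! i + 1])) / z \<le> (s + (base - 1) * base ^ (\<xi> ! i) / (2 * s)) / z"
    if "i < N" for i
    using upd[OF that, of "\<xi> ! i + 1"] z by (intro divide_right_mono) (auto simp: algebra_simps)
  have down: "sqrt (mass (\<xi>[i := \<xi> ! i - 1])) / z \<le> e i" if "i < N" for i
  proof -
    obtain k where k: "\<xi> ! i = Suc k"
      using configs_nth[OF \<xi> \<open>i < N\<close>] by (cases "\<xi> ! i") auto
    have "(base ^ (\<xi> ! i - 1) - base ^ (\<xi> ! i)) / (2 * s) =
        - ((1 - 1 / base) * base ^ (\<xi> ! i) / (2 * s))"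
      using b s by (simp add: k field_simps)
    then have "sqrt (mass (\<xi>[i := \<xi> ! i - 1])) \<le> s - (1 - 1 / base) * base ^ (\<xi> ! i) / (2 * s)"
      using upd[OF that, of "\<xi> ! i - 1"] by linarith
    then show ?thesis
      unfolding e_def using z by (intro divide_right_mono) auto
  qed
  have copy: "(\<Sum>j\<in>{..<N} - {i}. sqrt (mass (\<xi>[i := \<xi> ! j])) / real (card (copied D i j)))
      / (real N - 1) \<le> e i" if i: "i < N" "\<xi> ! i = 1" for i
  proof -
    have iD: "i \<notin> D" using D i by auto
    have one: "sqrt (mass (\<xi>[i := \<xi> ! j])) / real (card (copied D i j)) \<le>
        (s - base / (2 * s)) / z + base ^ (\<xi> ! j) / (2 * s * z) - (if j \<in> D then s / (z * (z + 1)) else 0)"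
      if "j < N" for j
    proof -
      define t where "t = sqrt (mass (\<xi>[i := \<xi> ! j]))"
      have t: "t / z \<le> (s - base / (2 * s)) / z + base ^ (\<xi> ! j) / (2 * s * z)"
        using upd[OF i(1), of "\<xi> ! j"] i z divide_right_mono[of t "s + (base ^ (\<xi> ! j) - base) / (2 * s)" z]
        by (simp add: t_def diff_divide_distrib add_divide_distrib)
      show ?thesis
      proof (cases "j \<in> D")
        case True
        have "base ^ 1 \<le> base ^ (\<xi> ! j)"
          using b configs_nth[OF \<xi> \<open>j < N\<close>] by (intro power_increasing) auto
        then have "mass \<xi> \<le> mass (\<xi>[i := \<xi> ! j])"
          using mass_update[OF configs_length[OF \<xi>] i(1), of "\<xi> ! j"] i by simp
        then have "s \<le> t" by (simp add: s_def t_def)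
        have "real (card (copied D i j)) = z + 1"
          using True iD fin by (simp add: copied_def z_def)
        moreover have "t / (z + 1) = t / z - t / (z * (z + 1))"
        proof -
          have "z \<noteq> 0" "z + 1 \<noteq> 0" using z by auto
          then show ?thesis by (simp add: divide_simps) (simp add: algebra_simps)
        qed
        moreover have "s / (z * (z + 1)) \<le> t / (z * (z + 1))"
          using \<open>s \<le> t\<close> z by (intro divide_right_mono) auto
        ultimately show ?thesis using t True by (simp add: t_def)
      next
        case False
        then show ?thesis using t by (simp add: copied_def t_def z_def)
      qed
    qed
    have card: "real (card ({..<N} - {i})) = real N - 1"
      using i N_ge by (simp add: of_nat_diff)
    have rest: "(\<Sum>j\<in>{..<N} - {i}. base ^ (\<xi> ! j)) = s * s - base"
      unfolding s(2) mass_def using i by (subst sum.remove[of "{..<N}" i]) auto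
    have "(\<Sum>j\<in>{..<N} - {i}. sqrt (mass (\<xi>[i := \<xi> ! j])) / real (card (copied D i j))) \<le>
        (\<Sum>j\<in>{..<N} - {i}. (s - base / (2 * s)) / z + base ^ (\<xi> ! j) / (2 * s * z)
          - (if j \<in> D then s / (z * (z + 1)) else 0))"
      using one by (intro sum_mono) auto
    also have "\<dots> = (real N - 1) * ((s - base / (2 * s)) / z) + (s * s - base) / (2 * s * z)
        - (\<Sum>j\<in>{..<N} - {i}. if j \<in> D then s / (z * (z + 1)) else 0)"
      using card rest by (simp add: sum.distrib sum_subtractf flip: sum_divide_distrib)
    \<comment> \<open>The killed walk is at site 1 and hence untracked, so all \<open>z\<close>
      tracked walks are among those that can be copied.\<close>
    also have "(\<Sum>j\<in>{..<N} - {i}. if j \<in> D then s / (z * (z + 1)) else 0) = z * (s / (z * (z + 1)))"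
    proof -
      have "({..<N} - {i}) \<inter> {j. j \<in> D} = D" using D iD by auto
      then show ?thesis by (simp add: sum.If_cases z_def)
    qed
    also have "(real N - 1) * ((s - base / (2 * s)) / z) + (s * s - base) / (2 * s * z)
        - z * (s / (z * (z + 1))) \<le> (real N - 1) * e i"
    proof -
      have "s / (2 * z) \<le> s / (z + 1)"
        using z s by (intro divide_left_mono) auto
      then have "s / (2 * z) \<le> z * (s / (z * (z + 1)))"
        using z by simp
      moreover have "(s * s - base) / (2 * s * z) \<le> (s * s) / (2 * s * z)"
        using z s b by (intro divide_right_mono) auto
      then have "(s * s - base) / (2 * s * z) \<le> s / (2 * z)"
        using z s(1) by simp
      \<comment> \<open>The kill removes \<open>base\<close> from the mass, which is more than the
        \<open>base - 1\<close> that a free step down from site 1 would remove.\<close>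
      moreover have "(real N - 1) * ((s - base / (2 * s)) / z) \<le> (real N - 1) * e i"
        using N z s b i unfolding e_def
        by (intro mult_left_mono divide_right_mono diff_left_mono) (auto simp: left_diff_distrib)
      ultimately show ?thesis by linarith
    qed
    finally show ?thesis using N by (simp add: field_simps)
  qed
  have "move_average \<xi> (\<lambda>i. sqrt (mass (\<xi>[i := \<xi> ! i + 1])) / real (card D))
      (\<lambda>i. sqrt (mass (\<xi>[i := \<xi> ! i - 1])) / real (card D))
      (\<lambda>i j. sqrt (mass (\<xi>[i := \<xi> ! j])) / real (card (copied D i j)))
    \<le> (\<Sum>i<N. p * ((s + (base - 1) * base ^ (\<xi> ! i) / (2 * s)) / z) + q * e i) / real N"
    unfolding move_average_def z_def[symmetric]
  proof (intro divide_right_mono[where c = "real N"] sum_mono add_mono mult_left_mono)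
    fix i assume "i \<in> {..<N}"
    then show "(if \<xi> ! i = 1 then (\<Sum>j\<in>{..<N} - {i}. sqrt (mass (\<xi>[i := \<xi> ! j])) / real (card (copied D i j)))
        / (real N - 1) else sqrt (mass (\<xi>[i := \<xi> ! i - 1])) / z) \<le> e i"
      using copy[of i] down[of i] by simp
  qed (use up p_pos q_pos in auto)
  also have "\<dots> = (\<Sum>i<N. s / z - gap / (2 * s * z) * base ^ (\<xi> ! i)) / real N"
  proof -
    have "p * ((s + (base - 1) * x / (2 * s)) / z) + q * ((s - (1 - 1 / base) * x / (2 * s)) / z)
        = (p + q) * (s / z) + (p * (base - 1) - q * (1 - 1 / base)) * x / (2 * s * z)" for x
      using s z by (simp add: field_simps)
    then show ?thesis
      unfolding e_def gap_eq using q_eq by simp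
  qed
  also have "\<dots> = (real N * (s / z) - gap / (2 * s * z) * (s * s)) / real N"
  proof -
    have "(\<Sum>i<N. x - y * base ^ (\<xi> ! i)) = real N * x - y * mass \<xi>" for x y
      by (simp add: sum_subtractf mass_def flip: sum_distrib_left)
    then show ?thesis by (simp only: s(2))
  qed
  also have "\<dots> = (1 - gap / (2 * real N)) * (s / z)"
    using s z N by (simp add: field_simps)
  finally show ?thesis by (simp add: s_def z_def)
qed

text \<open>For \<open>\<theta> = 1\<close> and \<open>D = {..<N}\<close> the depth is the constant \<open>N\<close> and this is a bound for \<open>sqrt f\<close>; for
  \<open>\<theta> = 1 / 2\<close> it controls the event that a tracked walk reaches site 1.\<close>

lemma move_average_sqrt_mass_depth_le:
  assumes \<xi>: "\<xi> \<in> configs N" and D: "D \<subseteq> {..<N}" and \<theta>: "1 / 2 \<le> \<theta>" "\<theta> \<le> 1"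
  shows "move_average \<xi> (\<lambda>i. sqrt (mass (\<xi>[i := \<xi> ! i + 1])) * depth \<theta> D (\<xi>[i := \<xi> ! i + 1]))
      (\<lambda>i. sqrt (mass (\<xi>[i := \<xi> ! i - 1])) * depth \<theta> D (\<xi>[i := \<xi> ! i - 1]))
      (\<lambda>i j. sqrt (mass (\<xi>[i := \<xi> ! j])) * depth \<theta> (copied D i j) (\<xi>[i := \<xi> ! j]))
    \<le> (1 + 6 / real N) * (sqrt (mass \<xi>) * depth \<theta> D \<xi>)"
proof -
  define s B where "s = sqrt (mass \<xi>)" and "B = depth \<theta> D \<xi>"
  \<comment> \<open>\<open>w\<close> sums to 1 and \<open>a\<close> to \<open>B\<close>. Moves
    change \<open>s * B\<close> relatively by multiples of these shares, so averaging over the walks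
    leaves a relative change of order \<open>1 / N\<close>.\<close>
  define w where "w i = base ^ (\<xi> ! i) / mass \<xi>" for i
  define a where "a i = (if i \<in> D then \<theta> ^ (\<xi> ! i) else 0)" for i
  have fin: "finite D" using D finite_subset by blast
  have s: "s > 0" "s * s = mass \<xi>"
    using mass_pos less_imp_le[OF mass_pos] by (auto simp: s_def)
  have B: "B \<ge> 0" using \<theta> by (simp add: B_def depth_nonneg)
  have N: "real N \<ge> 2" using N_ge by simp
  note len = configs_length[OF \<xi>]
  note upd = sqrt_mass_update[OF len, folded s_def]
  have b: "base > 1" "base > 0" using base_gt_1 by auto
  have w: "0 \<le> w i" "i < N \<Longrightarrow> w i \<le> 1" "base ^ (\<xi> ! i) / (2 * s) = s * (w i / 2)" for i
  proof -
    show "0 \<le> w i" using b less_imp_le[OF mass_pos] by (simp add: w_def)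
    show "w i \<le> 1" if "i < N"
    proof -
      have "base ^ (\<xi> ! i) \<le> mass \<xi>"
        unfolding mass_def using that b by (intro member_le_sum) auto
      then show ?thesis using mass_pos by (simp add: w_def)
    qed
    show "base ^ (\<xi> ! i) / (2 * s) = s * (w i / 2)"
      unfolding w_def s(2)[symmetric] using s(1) by (simp add: field_simps)
  qed
  have sum_w: "(\<Sum>i<N. w i) = 1"
    using mass_pos[of \<xi>] by (simp add: w_def mass_def flip: sum_divide_distrib)
  have a: "0 \<le> a i" for i using \<theta> by (simp add: a_def)
  have sum_a: "(\<Sum>i<N. a i) = B"
    using D by (simp add: a_def B_def depth_def sum.If_cases Int_absorb1)
  have up: "sqrt (mass (\<xi>[i := \<xi> ! i + 1])) * depth \<theta> D (\<xi>[i := \<xi> ! i + 1])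
      \<le> s * (1 + (base - 1) * (w i / 2)) * B" if "i < N" for i
  proof (intro mult_mono)
    show "sqrt (mass (\<xi>[i := \<xi> ! i + 1])) \<le> s * (1 + (base - 1) * (w i / 2))"
    proof -
      have "(base ^ (\<xi> ! i + 1) - base ^ (\<xi> ! i)) / (2 * s) = (base - 1) * (base ^ (\<xi> ! i) / (2 * s))"
        by (simp add: algebra_simps diff_divide_distrib)
      then show ?thesis
        using upd[OF that, of "\<xi> ! i + 1"] unfolding w(3)
        by (simp only: distrib_left mult_1_right mult.left_commute[of "base - 1"])
    qed
    have "\<theta> ^ (\<xi> ! i + 1) \<le> \<theta> ^ (\<xi> ! i)" using \<theta> by (intro power_decreasing) auto
    then show "depth \<theta> D (\<xi>[i := \<xi> ! i + 1]) \<le> B"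
      unfolding depth_update[OF len that D] B_def by auto
  qed (use s b w \<theta> in \<open>auto intro!: depth_nonneg mult_nonneg_nonneg add_nonneg_nonneg\<close>)
  have down: "sqrt (mass (\<xi>[i := \<xi> ! i - 1])) * depth \<theta> D (\<xi>[i := \<xi> ! i - 1])
      \<le> s * (B + a i)" if "i < N" for i
  proof (intro mult_mono)
    have "base ^ (\<xi> ! i - 1) \<le> base ^ (\<xi> ! i)" using b by (intro power_increasing) auto
    then show "sqrt (mass (\<xi>[i := \<xi> ! i - 1])) \<le> s"
      unfolding s_def mass_update[OF len that] by simp
    obtain k where k: "\<xi> ! i = Suc k"
      using configs_nth[OF \<xi> \<open>i < N\<close>] by (cases "\<xi> ! i") auto
    \<comment> \<open>A step down multiplies the contribution of the walk by
      \<open>1 / \<theta>\<close>; the lower bound on \<open>\<theta>\<close> makes this at most a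
      doubling.\<close>
    have "1 * \<theta> ^ k \<le> (2 * \<theta>) * \<theta> ^ k" using \<theta> by (intro mult_right_mono) auto
    then show "depth \<theta> D (\<xi>[i := \<xi> ! i - 1]) \<le> B + a i"
      unfolding depth_update[OF len that D] B_def a_def by (simp add: k)
  qed (use s \<theta> in \<open>auto intro!: depth_nonneg\<close>)
  have copy: "(\<Sum>j\<in>{..<N} - {i}. sqrt (mass (\<xi>[i := \<xi> ! j])) * depth \<theta> (copied D i j) (\<xi>[i := \<xi> ! j]))
      / (real N - 1) \<le> s * (B + 4 * B / real N)" if i: "i < N" "\<xi> ! i = 1" for i
  proof -
    have one: "sqrt (mass (\<xi>[i := \<xi> ! j])) * depth \<theta> (copied D i j) (\<xi>[i := \<xi> ! j])
        \<le> s * (B + w j * (B / 2) + 3 / 2 * a j)" if j: "j < N" for j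
    proof -
      have "sqrt (mass (\<xi>[i := \<xi> ! j])) \<le> s * (1 + w j / 2)"
      proof -
        have "(base ^ (\<xi> ! j) - base ^ (\<xi> ! i)) / (2 * s) \<le> base ^ (\<xi> ! j) / (2 * s)"
          using s b by (intro divide_right_mono) auto
        then have "sqrt (mass (\<xi>[i := \<xi> ! j])) \<le> s + base ^ (\<xi> ! j) / (2 * s)"
          using upd[OF i(1), of "\<xi> ! j"] by linarith
        then show ?thesis
          unfolding w(3) by (simp add: algebra_simps)
      qed
      moreover have "depth \<theta> (copied D i j) (\<xi>[i := \<xi> ! j]) \<le> B + a j"
      proof (cases "j \<in> D \<and> i \<notin> D")
        case True
        then have ins: "copied D i j = insert i D" "insert i D \<subseteq> {..<N}"
          using D i by (auto simp: copied_def)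
        have "depth \<theta> (insert i D) \<xi> = B + \<theta> ^ (\<xi> ! i)"
          using True fin by (simp add: depth_def B_def)
        then show ?thesis
          using depth_update[OF len i(1) ins(2), of \<theta> "\<xi> ! j"] True by (simp add: ins a_def)
      next
        case False
        then have "copied D i j = D" by (auto simp: copied_def)
        moreover have "\<theta> ^ (\<xi> ! j) \<le> \<theta> ^ 1"
          using \<theta> configs_nth[OF \<xi> j] by (intro power_decreasing) auto
        ultimately show ?thesis
          using depth_update[OF len i(1) D, of \<theta> "\<xi> ! j"] \<theta> i a[of j]
          by (simp add: B_def)
      qed
      ultimately have "sqrt (mass (\<xi>[i := \<xi> ! j])) * depth \<theta> (copied D i j) (\<xi>[i := \<xi> ! j])
          \<le> (s * (1 + w j / 2)) * (B + a j)"
        using s w \<theta> by (intro mult_mono) (auto intro!: depth_nonneg)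
      also have "\<dots> = s * (B + w j * (B / 2) + (1 + w j / 2) * a j)"
        by (simp add: algebra_simps)
      also have "\<dots> \<le> s * (B + w j * (B / 2) + 3 / 2 * a j)"
        using s w(2)[OF j] a[of j] by (intro mult_left_mono add_left_mono mult_right_mono) auto
      finally show ?thesis .
    qed
    have card: "real (card ({..<N} - {i})) = real N - 1"
      using i N_ge by (simp add: of_nat_diff)
    have le: "(\<Sum>j\<in>{..<N} - {i}. w j) \<le> 1" "(\<Sum>j\<in>{..<N} - {i}. a j) \<le> B"
      unfolding sum_w[symmetric] sum_a[symmetric] using w a by (auto intro!: sum_mono2)
    have "(\<Sum>j\<in>{..<N} - {i}. sqrt (mass (\<xi>[i := \<xi> ! j])) * depth \<theta> (copied D i j) (\<xi>[i := \<xi> ! j]))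
        \<le> (\<Sum>j\<in>{..<N} - {i}. s * (B + w j * (B / 2) + 3 / 2 * a j))"
      using one by (intro sum_mono) auto
    also have "\<dots> = s * ((real N - 1) * B + (\<Sum>j\<in>{..<N} - {i}. w j) * (B / 2)
        + 3 / 2 * (\<Sum>j\<in>{..<N} - {i}. a j))"
      unfolding sum_distrib_left[symmetric] sum.distrib
      using card by (simp only: sum_distrib_left[symmetric] sum_distrib_right[symmetric] sum_constant)
    also have "\<dots> \<le> s * ((real N - 1) * B + 1 * (B / 2) + 3 / 2 * B)"
      using s B le by (intro mult_left_mono add_mono mult_right_mono) auto
    also have "\<dots> = s * B * (real N + 1)"
      by (simp add: algebra_simps)
    finally have "(\<Sum>j\<in>{..<N} - {i}. sqrt (mass (\<xi>[i := \<xi> ! j])) * depth \<theta> (copied D i j) (\<xi>[i := \<xi> ! j]))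
      / (real N - 1) \<le> s * B * (real N + 1) / (real N - 1)"
      using N by (intro divide_right_mono) auto
    also have "\<dots> = s * B * ((real N + 1) / (real N - 1))" by simp
    also have "\<dots> \<le> s * B * (1 + 4 / real N)"
    proof -
      have "(real N + 1) / (real N - 1) \<le> 1 + 4 / real N"
        using N by (simp add: field_simps)
      then show ?thesis using s B by (intro mult_left_mono) auto
    qed
    finally show ?thesis by (simp add: algebra_simps)
  qed
  have "move_average \<xi> (\<lambda>i. sqrt (mass (\<xi>[i := \<xi> ! i + 1])) * depth \<theta> D (\<xi>[i := \<xi> ! i + 1]))
      (\<lambda>i. sqrt (mass (\<xi>[i := \<xi> ! i - 1])) * depth \<theta> D (\<xi>[i := \<xi> ! i - 1]))
      (\<lambda>i j. sqrt (mass (\<xi>[i := \<xi> ! j])) * depth \<theta> (copied D i j) (\<xi>[i := \<xi> ! j]))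
    \<le> (\<Sum>i<N. p * (s * (1 + (base - 1) * (w i / 2)) * B) + q * (s * (B + a i + 4 * B / real N))) / real N"
    unfolding move_average_def
  proof (intro divide_right_mono sum_mono add_mono mult_left_mono)
    fix i assume i: "i \<in> {..<N}"
    have "s * (B + 4 * B / real N) \<le> s * (B + a i + 4 * B / real N)"
      "s * (B + a i) \<le> s * (B + a i + 4 * B / real N)"
      using s a B by (auto intro!: mult_left_mono)
    then show "(if \<xi> ! i = 1 then (\<Sum>j\<in>{..<N} - {i}. sqrt (mass (\<xi>[i := \<xi> ! j])) * depth \<theta> (copied D i j) (\<xi>[i := \<xi> ! j]))
        / (real N - 1) else sqrt (mass (\<xi>[i := \<xi> ! i - 1])) * depth \<theta> D (\<xi>[i := \<xi> ! i - 1]))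
        \<le> s * (B + a i + 4 * B / real N)"
      using i copy[of i] down[of i] by (cases "\<xi> ! i = 1") auto
  qed (use up p_pos q_pos in auto)
  also have "\<dots> = s * B * (real N + p * (base - 1) / 2 + 5 * q) / real N"
  proof -
    have split: "p * (s * (1 + (base - 1) * (w i / 2)) * B) + q * (s * (B + a i + 4 * B / real N))
      = s * (B * ((p + q) + 4 * q / real N) + (p * (base - 1) / 2 * B) * w i + q * a i)" for i
      using N by (simp add: field_simps)
    have pq: "p + q = 1" using q_eq by simp
    have avg: "(\<Sum>i<N. s * (X + Y * w i + q * a i)) = s * (real N * X + Y + q * B)" for X Y
      using sum_w sum_a by (simp add: sum.distrib flip: sum_distrib_left)
    have "(\<Sum>i<N. p * (s * (1 + (base - 1) * (w i / 2)) * B) + q * (s * (B + a i + 4 * B / real N)))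
      = s * (real N * (B * (1 + 4 * q / real N)) + (p * (base - 1) / 2 * B) + q * B)"
      unfolding split pq avg ..
    also have "\<dots> = s * B * (real N + p * (base - 1) / 2 + 5 * q)"
      using N by (simp add: field_simps)
    finally show ?thesis by simp
  qed
  also have "\<dots> \<le> s * B * (real N + 6) / real N"
  proof (intro divide_right_mono mult_left_mono)
    \<comment> \<open>The constant 6 collects at most \<open>1 / 2\<close> from moves up, as
      \<open>p * base = 1 / 2\<close>, and at most 5 from moves down and kills.\<close>
    have "p * (base - 1) \<le> 1" using p_pos by (simp add: base_def right_diff_distrib)
    then show "real N + p * (base - 1) / 2 + 5 * q \<le> real N + 6"
      using q_eq p_pos by simp
  qed (use s B in auto)
  also have "\<dots> = (1 + 6 / real N) * (s * B)"
    using N by (simp add: field_simps)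
  finally show ?thesis by (simp add: s_def B_def)
qed

section \<open>Iteration over the number of jumps\<close>

lemma move_configs:
  assumes "\<xi> \<in> configs N" "i < N"
  shows "\<xi>[i := \<xi> ! i + 1] \<in> configs N"
    and "\<xi> ! i \<noteq> 1 \<Longrightarrow> \<xi>[i := \<xi> ! i - 1] \<in> configs N"
    and "j < N \<Longrightarrow> \<xi>[i := \<xi> ! j] \<in> configs N"
proof -
  have upd: "\<xi>[i := a] \<in> configs N" if "1 \<le> a" for a
    using assms that set_update_subset_insert[of \<xi> i a] by (fastforce simp: configs_def)
  show "\<xi>[i := \<xi> ! i + 1] \<in> configs N" by (rule upd) simp
  show "\<xi>[i := \<xi> ! i - 1] \<in> configs N" if "\<xi> ! i \<noteq> 1"
    using configs_nth[OF assms] that by (intro upd) auto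
  show "\<xi>[i := \<xi> ! j] \<in> configs N" if "j < N"
    using configs_nth[OF assms(1) that] by (intro upd)
qed

lemma copied_all: "j < N \<Longrightarrow> i < N \<Longrightarrow> copied {..<N} i j = {..<N}"
  by (auto simp: copied_def)

text \<open>Crude growth bound, valid from every configuration. It serves after tracking has been
  given up and for starting points near the origin.\<close>

lemma kernel_power_sqrt_mass_le:
  assumes "\<xi> \<in> configs N"
  shows "(\<integral>\<^sup>+ \<eta>. ennreal (sqrt (mass \<eta>)) \<partial>measure_pmf (kernel_power (fv_step p N) n \<xi>))
    \<le> ennreal ((1 + 6 / real N) ^ n * sqrt (mass \<xi>))"
  using assms
proof (induction n arbitrary: \<xi>)
  case (Suc n)
  define \<mu> where "\<mu> = 1 + 6 / real N"
  have \<mu>: "\<mu> \<ge> 0" by (simp add: \<mu>_def)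
  have [simp]: "mass \<eta> \<ge> 0" for \<eta> using mass_pos less_imp_le by blast
  have N: "real N > 0" using N_ge by simp
  define x where "x = \<mu> ^ n / real N"
  have x: "x \<ge> 0" using \<mu> by (simp add: x_def)
  have all: "x * (sqrt (mass \<eta>) * depth 1 {..<N} \<eta>) = \<mu> ^ n * sqrt (mass \<eta>)" for \<eta>
    using N by (simp add: depth_def x_def)
  have IH: "(\<integral>\<^sup>+ \<eta>. ennreal (sqrt (mass \<eta>)) \<partial>measure_pmf (kernel_power (fv_step p N) n \<zeta>))
      \<le> ennreal (x * (sqrt (mass \<zeta>) * depth 1 {..<N} \<zeta>))" if "\<zeta> \<in> configs N" for \<zeta>
    unfolding all using Suc.IH[OF that] by (simp add: \<mu>_def)
  \<comment> \<open>The padding \<open>+ 0 * 0\<close> brings the arguments into the form of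
    \<open>move_average_linear\<close>.\<close>
  have "(\<integral>\<^sup>+ \<eta>. ennreal (sqrt (mass \<eta>)) \<partial>measure_pmf (kernel_power (fv_step p N) (Suc n) \<xi>)) \<le>
      ennreal (move_average \<xi>
        (\<lambda>i. x * (sqrt (mass (\<xi>[i := \<xi> ! i + 1])) * depth 1 {..<N} (\<xi>[i := \<xi> ! i + 1])) + 0 * 0)
        (\<lambda>i. x * (sqrt (mass (\<xi>[i := \<xi> ! i - 1])) * depth 1 {..<N} (\<xi>[i := \<xi> ! i - 1])) + 0 * 0)
        (\<lambda>i j. x * (sqrt (mass (\<xi>[i := \<xi> ! j])) * depth 1 (copied {..<N} i j) (\<xi>[i := \<xi> ! j])) + 0 * 0))"
    unfolding nn_integral_kernel_power_Suc
  proof (rule nn_integral_fv_step_le)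
    fix i j assume "i < N" "j < N"
    then show "(\<integral>\<^sup>+ \<eta>. ennreal (sqrt (mass \<eta>)) \<partial>measure_pmf (kernel_power (fv_step p N) n (\<xi>[i := \<xi> ! j])))
        \<le> ennreal (x * (sqrt (mass (\<xi>[i := \<xi> ! j])) * depth 1 (copied {..<N} i j) (\<xi>[i := \<xi> ! j])) + 0 * 0)"
      using IH[OF move_configs(3)[OF Suc.prems]] by (simp add: copied_all)
  qed (use x IH move_configs[OF Suc.prems] in \<open>auto intro!: mult_nonneg_nonneg depth_nonneg\<close>)
  also have "\<dots> \<le> ennreal (x * (\<mu> * (sqrt (mass \<xi>) * depth 1 {..<N} \<xi>)))"
    unfolding move_average_linear \<mu>_def
    using move_average_sqrt_mass_depth_le[OF Suc.prems, of "{..<N}" 1] x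
    by (intro ennreal_leI) (simp add: mult_left_mono)
  also have "x * (\<mu> * (sqrt (mass \<xi>) * depth 1 {..<N} \<xi>)) = \<mu> * (x * (sqrt (mass \<xi>) * depth 1 {..<N} \<xi>))"
    by simp
  also have "\<dots> = \<mu> ^ Suc n * sqrt (mass \<xi>)"
    unfolding all by simp
  finally show ?case by (simp add: \<mu>_def)
qed simp

text \<open>The first summand decays as long as tracking lasts; its factor \<open>N\<close> pays for
  \<open>card D \<le> N\<close> at the end of the induction. The second grows at the crude rate but
  starts from a small depth, and takes over once a tracked walk reaches site 1. As \<open>D\<close>
  is arbitrary, the induction hypothesis applies to the set produced by each move.\<close>

lemma kernel_power_sqrt_mass_tracked_le:
  assumes "\<xi> \<in> configs N" "D \<noteq> {}" "D \<subseteq> {..<N}"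
  shows "(\<integral>\<^sup>+ \<eta>. ennreal (sqrt (mass \<eta>)) \<partial>measure_pmf (kernel_power (fv_step p N) n \<xi>))
    \<le> ennreal (real N * (1 - gap / (2 * real N)) ^ n * (sqrt (mass \<xi>) / real (card D))
        + 2 * real N * (1 + 6 / real N) ^ n * (sqrt (mass \<xi>) * depth (1 / 2) D \<xi>))"
  using assms
proof (induction n arbitrary: \<xi> D)
  case (0 \<xi> D)
  have "finite D" using 0 finite_subset by blast
  then have "1 \<le> card D" "card D \<le> N"
    using 0 card_mono[of "{..<N}" D] by (auto simp: Suc_le_eq card_gt_0_iff)
  then have "sqrt (mass \<xi>) * 1 \<le> sqrt (mass \<xi>) * (real N / real (card D))"
    using less_imp_le[OF mass_pos] by (intro mult_left_mono) auto
  moreover have "0 \<le> 2 * real N * (sqrt (mass \<xi>) * depth (1 / 2) D \<xi>)"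
    using less_imp_le[OF mass_pos] by (intro mult_nonneg_nonneg depth_nonneg) auto
  ultimately show ?case by (auto intro!: ennreal_leI simp: mult.commute)
next
  case (Suc n \<xi> D)
  define \<mu> \<rho> where "\<mu> = 1 + 6 / real N" and "\<rho> = 1 - gap / (2 * real N)"
  have N: "real N \<ge> 2" using N_ge by simp
  have \<mu>: "\<mu> \<ge> 1" by (simp add: \<mu>_def)
  have \<rho>: "\<rho> \<ge> 0" using gap_pos N by (simp add: \<rho>_def field_simps)
  have [simp]: "mass \<eta> \<ge> 0" for \<eta> using mass_pos less_imp_le by blast
  define x y where "x = real N * \<rho> ^ n" and "y = 2 * real N * \<mu> ^ n"
  have xy: "x \<ge> 0" "y \<ge> 0" using \<mu> \<rho> by (auto simp: x_def y_def)
  have depth: "depth (1 / 2) D' \<eta> \<ge> 0" for D' \<eta> by (simp add: depth_nonneg)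
  show ?case
  proof (cases "\<exists>i\<in>D. \<xi> ! i = 1")
    case True
    then obtain i where i: "i \<in> D" "\<xi> ! i = 1" by blast
    have "finite D" using Suc.prems finite_subset by blast
    then have "(1 / 2) ^ (\<xi> ! i) \<le> depth (1 / 2) D \<xi>"
      unfolding depth_def using i by (intro member_le_sum) auto
    \<comment> \<open>With depth at least \<open>1 / 2\<close> the second summand alone exceeds the
      crude bound, so no tracked set is needed for the remaining jumps.\<close>
    then have half: "1 / 2 \<le> depth (1 / 2) D \<xi>" using i by simp
    have "\<mu> ^ Suc n * sqrt (mass \<xi>) * 1 \<le> \<mu> ^ Suc n * sqrt (mass \<xi>) * (2 * real N * depth (1 / 2) D \<xi>)"
    proof (rule mult_left_mono)
      have "1 * (1 / 2) \<le> real N * depth (1 / 2) D \<xi>"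
        using N half by (intro mult_mono) auto
      then show "1 \<le> 2 * real N * depth (1 / 2) D \<xi>" by simp
    qed (use \<mu> in auto)
    also have "\<dots> = 2 * real N * \<mu> ^ Suc n * (sqrt (mass \<xi>) * depth (1 / 2) D \<xi>)" by simp
    also have "\<dots> \<le> real N * \<rho> ^ Suc n * (sqrt (mass \<xi>) / real (card D))
        + 2 * real N * \<mu> ^ Suc n * (sqrt (mass \<xi>) * depth (1 / 2) D \<xi>)"
      using \<rho> by (simp del: power_Suc)
    finally show ?thesis
      using order_trans[OF kernel_power_sqrt_mass_le[OF Suc.prems(1), of "Suc n"] ennreal_leI]
      by (simp add: \<mu>_def \<rho>_def del: power_Suc)
  next
    case False
    have IH: "(\<integral>\<^sup>+ \<eta>. ennreal (sqrt (mass \<eta>)) \<partial>measure_pmf (kernel_power (fv_step p N) n \<zeta>))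
        \<le> ennreal (x * (sqrt (mass \<zeta>) / real (card D')) + y * (sqrt (mass \<zeta>) * depth (1 / 2) D' \<zeta>))"
      if "\<zeta> \<in> configs N" "D' \<noteq> {}" "D' \<subseteq> {..<N}" for \<zeta> D'
      using Suc.IH[OF that] by (simp add: \<mu>_def \<rho>_def x_def y_def)
    have cop: "copied D i j \<noteq> {}" "copied D i j \<subseteq> {..<N}" if "i < N" for i j
      using Suc.prems that by (auto simp: copied_def)
    let ?u = "\<lambda>i. sqrt (mass (\<xi>[i := \<xi> ! i + 1])) / real (card D)"
    let ?d = "\<lambda>i. sqrt (mass (\<xi>[i := \<xi> ! i - 1])) / real (card D)"
    let ?c = "\<lambda>i j. sqrt (mass (\<xi>[i := \<xi> ! j])) / real (card (copied D i j))"
    let ?u' = "\<lambda>i. sqrt (mass (\<xi>[i := \<xi> ! i + 1])) * depth (1 / 2) D (\<xi>[i := \<xi> ! i + 1])"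
    let ?d' = "\<lambda>i. sqrt (mass (\<xi>[i := \<xi> ! i - 1])) * depth (1 / 2) D (\<xi>[i := \<xi> ! i - 1])"
    let ?c' = "\<lambda>i j. sqrt (mass (\<xi>[i := \<xi> ! j])) * depth (1 / 2) (copied D i j) (\<xi>[i := \<xi> ! j])"
    have "(\<integral>\<^sup>+ \<eta>. ennreal (sqrt (mass \<eta>)) \<partial>measure_pmf (kernel_power (fv_step p N) (Suc n) \<xi>)) \<le>
        ennreal (move_average \<xi> (\<lambda>i. x * ?u i + y * ?u' i) (\<lambda>i. x * ?d i + y * ?d' i)
          (\<lambda>i j. x * ?c i j + y * ?c' i j))"
      unfolding nn_integral_kernel_power_Suc
    proof (rule nn_integral_fv_step_le)
      fix i assume i: "i < N"
      show "(\<integral>\<^sup>+ \<eta>. ennreal (sqrt (mass \<eta>)) \<partial>measure_pmf (kernel_power (fv_step p N) n (\<xi>[i := \<xi> ! i + 1])))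
          \<le> ennreal (x * ?u i + y * ?u' i)"
        by (intro IH move_configs Suc.prems i)
      show "(\<integral>\<^sup>+ \<eta>. ennreal (sqrt (mass \<eta>)) \<partial>measure_pmf (kernel_power (fv_step p N) n (\<xi>[i := \<xi> ! i - 1])))
          \<le> ennreal (x * ?d i + y * ?d' i)" if "\<xi> ! i \<noteq> 1"
        by (intro IH move_configs Suc.prems i that)
      show "(\<integral>\<^sup>+ \<eta>. ennreal (sqrt (mass \<eta>)) \<partial>measure_pmf (kernel_power (fv_step p N) n (\<xi>[i := \<xi> ! j])))
          \<le> ennreal (x * ?c i j + y * ?c' i j)" if "j < N" for j
        by (intro IH move_configs Suc.prems i that cop)
    qed (use xy depth in \<open>auto intro!: add_nonneg_nonneg mult_nonneg_nonneg\<close>)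
    also have "\<dots> \<le> ennreal (x * (\<rho> * (sqrt (mass \<xi>) / real (card D)))
        + y * (\<mu> * (sqrt (mass \<xi>) * depth (1 / 2) D \<xi>)))"
      unfolding move_average_linear \<mu>_def \<rho>_def
      by (intro ennreal_leI add_mono mult_left_mono xy move_average_sqrt_mass_le
          move_average_sqrt_mass_depth_le Suc.prems) (use False in auto)
    also have "x * (\<rho> * (sqrt (mass \<xi>) / real (card D))) + y * (\<mu> * (sqrt (mass \<xi>) * depth (1 / 2) D \<xi>)) =
      real N * \<rho> ^ Suc n * (sqrt (mass \<xi>) / real (card D))
        + 2 * real N * \<mu> ^ Suc n * (sqrt (mass \<xi>) * depth (1 / 2) D \<xi>)"
      by (simp add: x_def y_def)
    finally show ?thesis by (simp add: \<mu>_def \<rho>_def)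
  qed
qed

section \<open>The rightmost walk\<close>

text \<open>\<open>fleming_viot\<close> is only a choice among transition functions. Uniqueness
  identifies it with the explicit semigroup that runs the jump chain for a Poisson number of
  steps.\<close>

lemma fleming_viot_eq:
  assumes "\<xi> \<in> configs N" "t > 0"
  shows "fleming_viot p q N t \<xi> =
    bind_pmf (poisson_pmf (real N * t)) (\<lambda>n. kernel_power (fv_step p N) n \<xi>)"
proof -
  interpret uniformizable "configs N" "fv_rate p q N" "real N" "fv_step p N"
    using N_ge p_pos q_eq q_pos by (rule uniformizable_fv)
  have "poisson_semigroup t \<xi> = fleming_viot p q N t \<xi>"
    using N_ge p_pos q_eq q_pos transition_function_exists less_imp_le[OF assms(2)] assms(1)
    by (rule fleming_viot_unique)
  then show ?thesis using assms by (simp add: poisson_semigroup_def)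
qed

text \<open>The Poisson generating function with mean \<open>N * t\<close> turns the factor
  \<open>1 + 6 / N\<close> per jump into \<open>exp (6 * t)\<close>.\<close>

lemma fleming_viot_sqrt_mass_le:
  assumes \<xi>: "\<xi> \<in> configs N" and t: "t > 0"
  shows "(\<integral>\<^sup>+ \<eta>. ennreal (sqrt (mass \<eta>)) \<partial>measure_pmf (fleming_viot p q N t \<xi>))
    \<le> ennreal (exp (6 * t) * sqrt (mass \<xi>))"
proof -
  have N: "real N > 0" using N_ge by simp
  have [simp]: "mass \<eta> \<ge> 0" for \<eta> using mass_pos less_imp_le by blast
  have "(\<integral>\<^sup>+ \<eta>. ennreal (sqrt (mass \<eta>)) \<partial>measure_pmf (fleming_viot p q N t \<xi>)) \<le>
      (\<integral>\<^sup>+ n. ennreal ((1 + 6 / real N) ^ n * sqrt (mass \<xi>)) \<partial>measure_pmf (poisson_pmf (real N * t)))"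
    unfolding fleming_viot_eq[OF assms] nn_integral_bind_pmf
    by (intro nn_integral_mono kernel_power_sqrt_mass_le \<xi>)
  also have "\<dots> = ennreal (exp (real N * t * (1 + 6 / real N - 1))) * ennreal (sqrt (mass \<xi>))"
    using N t by (simp add: ennreal_mult nn_integral_multc nn_integral_poisson_power)
  also have "\<dots> = ennreal (exp (6 * t) * sqrt (mass \<xi>))"
    using N by (simp add: ennreal_mult mult.commute)
  finally show ?thesis .
qed

text \<open>Tracking starts from the single walk \<open>i\<close>: the cardinality is 1 and the
  depth \<open>(1 / 2) ^ (\<xi> ! i)\<close>.\<close>

lemma fleming_viot_sqrt_mass_tracked_le:
  assumes \<xi>: "\<xi> \<in> configs N" and t: "t > 0" and i: "i < N"
  shows "(\<integral>\<^sup>+ \<eta>. ennreal (sqrt (mass \<eta>)) \<partial>measure_pmf (fleming_viot p q N t \<xi>))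
    \<le> ennreal (real N * sqrt (mass \<xi>) * (exp (- gap * t / 2) + 2 * (1 / 2) ^ (\<xi> ! i) * exp (6 * t)))"
proof -
  have N: "real N \<ge> 2" using N_ge by simp
  have [simp]: "mass \<eta> \<ge> 0" for \<eta> using mass_pos less_imp_le by blast
  define \<rho> \<mu> where "\<rho> = 1 - gap / (2 * real N)" and "\<mu> = 1 + 6 / real N"
  have pos: "\<rho> \<ge> 0" "\<mu> \<ge> 0" using gap_pos N by (auto simp: \<rho>_def \<mu>_def field_simps)
  define x y where "x = real N * sqrt (mass \<xi>)" and "y = 2 * real N * sqrt (mass \<xi>) * (1 / 2) ^ (\<xi> ! i)"
  have xy: "x \<ge> 0" "y \<ge> 0" by (auto simp: x_def y_def)
  have "(\<integral>\<^sup>+ \<eta>. ennreal (sqrt (mass \<eta>)) \<partial>measure_pmf (fleming_viot p q N t \<xi>)) \<le>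
      (\<integral>\<^sup>+ n. ennreal (x * \<rho> ^ n + y * \<mu> ^ n) \<partial>measure_pmf (poisson_pmf (real N * t)))"
    unfolding fleming_viot_eq[OF \<xi> t] nn_integral_bind_pmf
  proof (rule nn_integral_mono)
    fix n
    show "(\<integral>\<^sup>+ \<eta>. ennreal (sqrt (mass \<eta>)) \<partial>measure_pmf (kernel_power (fv_step p N) n \<xi>))
        \<le> ennreal (x * \<rho> ^ n + y * \<mu> ^ n)"
      using kernel_power_sqrt_mass_tracked_le[OF \<xi>, of "{i}" n] i
      by (simp add: depth_def x_def y_def \<rho>_def \<mu>_def mult_ac)
  qed
  also have "\<dots> = ennreal x * ennreal (exp (real N * t * (\<rho> - 1))) + ennreal y * ennreal (exp (real N * t * (\<mu> - 1)))"
    using xy pos N t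
    by (simp add: ennreal_mult nn_integral_add nn_integral_cmult nn_integral_poisson_power)
  also have "real N * t * (\<rho> - 1) = - gap * t / 2" using N by (simp add: \<rho>_def)
  also have "real N * t * (\<mu> - 1) = 6 * t" using N by (simp add: \<mu>_def)
  also have "ennreal x * ennreal (exp (- gap * t / 2)) + ennreal y * ennreal (exp (6 * t)) =
      ennreal (x * exp (- gap * t / 2) + y * exp (6 * t))"
    using xy by (simp add: ennreal_plus ennreal_mult)
  also have "x * exp (- gap * t / 2) + y * exp (6 * t) =
      real N * sqrt (mass \<xi>) * (exp (- gap * t / 2) + 2 * (1 / 2) ^ (\<xi> ! i) * exp (6 * t))"
    by (simp add: x_def y_def algebra_simps)
  finally show ?thesis .
qed

text \<open>\<open>exp rate\<close> is the square root of \<open>base\<close>, so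
  \<open>exp (rate * m)\<close> is what a walk at height \<open>m\<close> alone contributes to
  \<open>sqrt f\<close>. It also becomes the threshold for \<open>\<delta>\<close>.\<close>

definition rate :: real where "rate = ln base / 2"

lemma rate_pos: "rate > 0"
  using base_gt_1 by (simp add: rate_def)

lemma rightmost_nth:
  assumes "\<xi> \<in> configs N"
  obtains i where "i < N" "\<xi> ! i = rightmost \<xi>" "\<And>j. j < N \<Longrightarrow> \<xi> ! j \<le> rightmost \<xi>"
proof -
  have len: "length \<xi> = N" using assms by (rule configs_length)
  then have "set \<xi> \<noteq> {}" using N_ge by auto
  then have "Max (set \<xi>) \<in> set \<xi>" by (intro Max_in) auto
  then obtain i where "i < N" "\<xi> ! i = rightmost \<xi>"
    using len by (auto simp: rightmost_def in_set_conv_nth)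
  moreover have "\<xi> ! j \<le> rightmost \<xi>" if "j < N" for j
    using that len by (auto simp: rightmost_def intro!: Max_ge)
  ultimately show ?thesis using that by blast
qed

lemma exp_rate_power2: "(exp (rate * real m))\<^sup>2 = base ^ m"
proof -
  have "(exp (rate * real m))\<^sup>2 = exp (real m * ln base)"
    by (simp add: rate_def power2_eq_square flip: exp_add)
  also have "\<dots> = base ^ m"
    using base_gt_1 by (subst exp_of_nat_mult) simp
  finally show ?thesis .
qed

lemma exp_rightmost_le_sqrt_mass:
  assumes "\<xi> \<in> configs N"
  shows "exp (rate * real (rightmost \<xi>)) \<le> sqrt (mass \<xi>)"
proof (rule real_le_rsqrt)
  obtain i where i: "i < N" "\<xi> ! i = rightmost \<xi>" using rightmost_nth[OF assms] by blast
  have "base ^ (\<xi> ! i) \<le> mass \<xi>"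
    unfolding mass_def using i base_gt_1 by (intro member_le_sum) auto
  then show "(exp (rate * real (rightmost \<xi>)))\<^sup>2 \<le> mass \<xi>"
    by (simp add: exp_rate_power2 i)
qed

lemma sqrt_mass_le_exp_rightmost:
  assumes "\<xi> \<in> configs N"
  shows "sqrt (mass \<xi>) \<le> exp (ln (real N) / 2 + rate * real (rightmost \<xi>))"
proof (rule real_le_lsqrt)
  have "mass \<xi> \<le> (\<Sum>i<N. base ^ rightmost \<xi>)"
    unfolding mass_def
  proof (rule sum_mono)
    fix i assume "i \<in> {..<N}"
    then have "\<xi> ! i \<le> rightmost \<xi>" using rightmost_nth[OF assms] by blast
    then show "base ^ (\<xi> ! i) \<le> base ^ rightmost \<xi>"
      using base_gt_1 by (intro power_increasing) auto
  qed
  also have "\<dots> = (exp (ln (real N) / 2) * exp (rate * real (rightmost \<xi>)))\<^sup>2"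
    unfolding power_mult_distrib exp_rate_power2 using N_ge
    by (simp add: power2_eq_square flip: exp_add)
  finally show "mass \<xi> \<le> (exp (ln (real N) / 2 + rate * real (rightmost \<xi>)))\<^sup>2"
    by (simp add: exp_add)
qed simp

lemma fleming_viot_configs:
  assumes "\<xi> \<in> configs N" "t \<ge> 0"
  shows "set_pmf (fleming_viot p q N t \<xi>) \<subseteq> configs N"
  using transition_function_fleming_viot[OF N_ge p_pos q_eq q_pos] assms
  by (simp add: transition_function_def)

lemma nn_integral_exp_rightmost_le:
  assumes "\<xi> \<in> configs N" "t \<ge> 0"
  shows "(\<integral>\<^sup>+ \<eta>. ennreal (exp (rate * real (rightmost \<eta>))) \<partial>measure_pmf (fleming_viot p q N t \<xi>))
    \<le> (\<integral>\<^sup>+ \<eta>. ennreal (sqrt (mass \<eta>)) \<partial>measure_pmf (fleming_viot p q N t \<xi>))"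
  using fleming_viot_configs[OF assms]
  by (intro nn_integral_mono_AE AE_pmfI ennreal_leI exp_rightmost_le_sqrt_mass) auto

text \<open>The window length \<open>time_factor * ln N\<close> is chosen so that the decay \<open>exp (- gap * t / 2)\<close>
  beats the prefactors \<open>N\<close> and \<open>sqrt N\<close> by a factor \<open>N\<^sup>2\<close>, and \<open>level\<close> so that with the same margin
  no copy of the rightmost walk reaches site 1 in that window.\<close>

definition time_factor :: real where "time_factor = 7 / gap"

definition level :: real where "level = (6 * time_factor + 5) / ln 2"

text \<open>Chosen so that the crude factor \<open>exp (6 * t)\<close>, the factor
  \<open>sqrt N\<close> between \<open>sqrt f\<close> and the maximum, and a start at height
  \<open>level * ln N\<close> multiply to \<open>exp (rate * growth * ln N)\<close>.\<close>

definition growth :: real where "growth = (6 * time_factor + 1 / 2) / rate + level"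

lemma time_factor_pos: "time_factor > 0"
  using gap_pos by (simp add: time_factor_def)

lemma level_pos: "level > 0"
  using time_factor_pos by (simp add: level_def add_pos_pos)

lemma growth_pos: "growth > 0"
  unfolding growth_def using time_factor_pos level_pos rate_pos
  by (intro add_pos_pos divide_pos_pos) auto

lemma ln_N: "ln (real N) \<ge> ln 2" "ln (real N) > 0"
  using N_ge by auto

lemma exp_rightmost_low:
  assumes \<xi>: "\<xi> \<in> configs N" and low: "real (rightmost \<xi>) \<le> level * ln (real N)"
  defines "M \<equiv> fleming_viot p q N (time_factor * ln (real N)) \<xi>"
  shows "integrable M (\<lambda>\<eta>. exp (rate * real (rightmost \<eta>)))"
    and "measure_pmf.expectation M (\<lambda>\<eta>. exp (rate * real (rightmost \<eta>)))
      \<le> exp (rate * growth * ln (real N))"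
proof -
  define L t where "L = ln (real N)" and "t = time_factor * ln (real N)"
  have t: "t > 0" using time_factor_pos ln_N by (simp add: t_def)
  have "(\<integral>\<^sup>+ \<eta>. ennreal (exp (rate * real (rightmost \<eta>))) \<partial>measure_pmf M)
      \<le> ennreal (exp (6 * t) * sqrt (mass \<xi>))"
    unfolding M_def t_def[symmetric]
    using nn_integral_exp_rightmost_le[OF \<xi> less_imp_le[OF t]] fleming_viot_sqrt_mass_le[OF \<xi> t]
    by (rule order_trans)
  also have "\<dots> \<le> ennreal (exp (rate * growth * L))"
  proof (rule ennreal_leI)
    have "exp (6 * t) * sqrt (mass \<xi>) \<le> exp (6 * t) * exp (L / 2 + rate * real (rightmost \<xi>))"
      using sqrt_mass_le_exp_rightmost[OF \<xi>] by (intro mult_left_mono) (auto simp: L_def)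
    also have "\<dots> = exp (6 * t + L / 2 + rate * real (rightmost \<xi>))"
      by (simp add: exp_add)
    also have "\<dots> \<le> exp (6 * t + L / 2 + rate * (level * L))"
      using low rate_pos by (simp add: L_def)
    also have "6 * t + L / 2 + rate * (level * L) = rate * growth * L"
      using rate_pos by (simp add: t_def L_def growth_def field_simps)
    finally show "exp (6 * t) * sqrt (mass \<xi>) \<le> exp (rate * growth * L)" .
  qed
  finally have "(\<integral>\<^sup>+ \<eta>. ennreal (exp (rate * real (rightmost \<eta>))) \<partial>measure_pmf M)
      \<le> ennreal (exp (rate * growth * L))" .
  from expectation_le_of_nn_integral_le[OF _ this]
  show "integrable M (\<lambda>\<eta>. exp (rate * real (rightmost \<eta>)))"
    "measure_pmf.expectation M (\<lambda>\<eta>. exp (rate * real (rightmost \<eta>)))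
      \<le> exp (rate * growth * ln (real N))"
    by (simp_all add: L_def)
qed

lemma exp_rightmost_high:
  assumes \<xi>: "\<xi> \<in> configs N" and high: "real (rightmost \<xi>) > level * ln (real N)"
  defines "M \<equiv> fleming_viot p q N (time_factor * ln (real N)) \<xi>"
  shows "integrable M (\<lambda>\<eta>. exp (rate * real (rightmost \<eta>)))"
    and "measure_pmf.expectation M (\<lambda>\<eta>. exp (rate * real (rightmost \<eta>)))
      \<le> exp (rate * real (rightmost \<xi>) - ln (real N))"
proof -
  define L t m where "L = ln (real N)" and "t = time_factor * ln (real N)" and "m = rightmost \<xi>"
  have t: "t > 0" using time_factor_pos ln_N by (simp add: t_def)
  have L: "exp L = real N" "2 \<le> exp L" using N_ge by (auto simp: L_def)
  obtain i where i: "i < N" "\<xi> ! i = m" using rightmost_nth[OF \<xi>] by (auto simp: m_def)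
  have "(\<integral>\<^sup>+ \<eta>. ennreal (exp (rate * real (rightmost \<eta>))) \<partial>measure_pmf M)
      \<le> ennreal (real N * sqrt (mass \<xi>) * (exp (- gap * t / 2) + 2 * (1 / 2) ^ m * exp (6 * t)))"
    unfolding M_def t_def[symmetric] i(2)[symmetric]
    using nn_integral_exp_rightmost_le[OF \<xi> less_imp_le[OF t]] fleming_viot_sqrt_mass_tracked_le[OF \<xi> t i(1)]
    by (rule order_trans)
  also have "\<dots> \<le> ennreal (exp (rate * real m - L))"
  proof (rule ennreal_leI)
    have "- gap * t / 2 = - 7 / 2 * L"
      using gap_pos by (simp add: t_def time_factor_def L_def)
    moreover have "2 * (1 / 2) ^ m * exp (6 * t) \<le> exp (- 7 / 2 * L)"
    proof -
      have "exp (real m * ln 2) = (2 :: real) ^ m"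
        by (subst exp_of_nat_mult) simp
      then have "exp (- (real m * ln 2)) = (1 / 2 :: real) ^ m"
        unfolding exp_minus by (simp only: power_one_over inverse_eq_divide)
      then have "2 * (1 / 2) ^ m * exp (6 * t) \<le> exp L * exp (- (real m * ln 2)) * exp (6 * t)"
        using L by simp
      also have "\<dots> = exp (L - real m * ln 2 + 6 * t)"
        by (simp flip: exp_add)
      also have "\<dots> \<le> exp (- 7 / 2 * L)"
      \<comment> \<open>\<open>level\<close> cancels \<open>6 * t\<close> and leaves
        \<open>- 4 * L\<close>, slightly below the required \<open>- 7 / 2 * L\<close>.\<close>
      proof -
        have "level * L * ln 2 \<le> real m * ln 2"
          using high by (intro mult_right_mono) (auto simp: m_def L_def)
        moreover have "level * L * ln 2 = 6 * t + 5 * L"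
        proof -
          have "level * ln 2 = 6 * time_factor + 5" by (simp add: level_def)
          then have "(level * ln 2) * L = (6 * time_factor + 5) * L" by simp
          then show ?thesis by (simp add: t_def L_def algebra_simps)
        qed
        moreover have "L > 0" using ln_N by (simp add: L_def)
        ultimately show ?thesis by simp
      qed
      finally show ?thesis .
    qed
    ultimately have "exp (- gap * t / 2) + 2 * (1 / 2) ^ m * exp (6 * t) \<le> 2 * exp (- 7 / 2 * L)"
      by simp
    \<comment> \<open>One of the two spare powers of \<open>N\<close> absorbs the constant 2; the
      other one is the gain \<open>exp (- L)\<close> of the lemma.\<close>
    also have "\<dots> \<le> exp L * exp (- 7 / 2 * L)"
      using L by (intro mult_right_mono) auto
    finally have "real N * sqrt (mass \<xi>) * (exp (- gap * t / 2) + 2 * (1 / 2) ^ m * exp (6 * t))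
        \<le> exp L * exp (L / 2 + rate * real m) * (exp L * exp (- 7 / 2 * L))"
      using sqrt_mass_le_exp_rightmost[OF \<xi>] less_imp_le[OF mass_pos]
      by (intro mult_mono) (auto simp: L m_def L_def[symmetric])
    also have "\<dots> = exp (rate * real m - L)"
      by (simp add: algebra_simps flip: exp_add)
    finally show "real N * sqrt (mass \<xi>) * (exp (- gap * t / 2) + 2 * (1 / 2) ^ m * exp (6 * t))
        \<le> exp (rate * real m - L)" .
  qed
  finally have "(\<integral>\<^sup>+ \<eta>. ennreal (exp (rate * real (rightmost \<eta>))) \<partial>measure_pmf M)
      \<le> ennreal (exp (rate * real m - L))" .
  from expectation_le_of_nn_integral_le[OF _ this]
  show "integrable M (\<lambda>\<eta>. exp (rate * real (rightmost \<eta>)))"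
    "measure_pmf.expectation M (\<lambda>\<eta>. exp (rate * real (rightmost \<eta>)))
      \<le> exp (rate * real (rightmost \<xi>) - ln (real N))"
    by (simp_all add: L_def m_def)
qed

section \<open>Accessibility, the drift condition and the invariant measure\<close>

lemma kernel_power_reaches_ones:
  assumes "\<xi> \<in> configs N"
  shows "\<exists>n. replicate N 1 \<in> set_pmf (kernel_power (fv_step p N) n \<xi>)"
  using assms
proof (induction "sum_list \<xi>" arbitrary: \<xi> rule: less_induct)
  case less
  have len: "length \<xi> = N" using less.prems by (rule configs_length)
  show ?case
  proof (cases "\<exists>i<N. \<xi> ! i \<noteq> 1")
    case True
    then obtain i where i: "i < N" "\<xi> ! i \<noteq> 1" by blast
    let ?\<eta> = "\<xi>[i := \<xi> ! i - 1]"
    have \<eta>: "?\<eta> \<in> configs N" using i less.prems by (intro move_configs)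
    have "\<xi> ! i \<ge> 1" using configs_nth less.prems i by blast
    moreover have "\<xi> ! i \<le> sum_list \<xi>" using i len by (intro elem_le_sum_list) auto
    ultimately have "sum_list ?\<eta> < sum_list \<xi>"
      using i len by (simp add: sum_list_update)
    from less.hyps[OF this \<eta>]
    obtain n where n: "replicate N 1 \<in> set_pmf (kernel_power (fv_step p N) n ?\<eta>)" by blast
    have "?\<eta> \<in> set_pmf (fv_step p N \<xi>)"
    proof -
      have "set_pmf (bernoulli_pmf p) = UNIV" using p_pos q_pos q_eq by auto
      then show ?thesis
        using i N_ge by (auto simp: fv_step_def lessThan_empty_iff intro!: bexI[of _ i] exI[of _ False])
    qed
    then have "replicate N 1 \<in> set_pmf (kernel_power (fv_step p N) (Suc n) \<xi>)"
      using n by auto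
    then show ?thesis by blast
  next
    case False
    then have "\<xi> = replicate N 1" using len by (intro nth_equalityI) auto
    then have "replicate N 1 \<in> set_pmf (kernel_power (fv_step p N) 0 \<xi>)" by simp
    then show ?thesis by blast
  qed
qed

text \<open>Above the level the expectation drops by the factor \<open>1 / N\<close>, which is at
  most the \<open>1 / 2\<close> of the drift condition; below the level it is bounded by the
  additive constant.\<close>

lemma harris_kernel_fleming_viot:
  "harris_kernel (configs N) (fleming_viot p q N (time_factor * ln (real N)))
    (\<lambda>\<xi>. exp (rate * real (rightmost \<xi>))) (exp (rate * growth * ln (real N))) (replicate N 1)"
proof
  define T where "T = time_factor * ln (real N)"
  have T: "T > 0" using time_factor_pos ln_N by (simp add: T_def)
  fix \<xi> assume \<xi>: "\<xi> \<in> configs N"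
  show "set_pmf (fleming_viot p q N (time_factor * ln (real N)) \<xi>) \<subseteq> configs N"
    using fleming_viot_configs[OF \<xi>] T by (simp add: T_def)
  show "integrable (fleming_viot p q N (time_factor * ln (real N)) \<xi>) (\<lambda>\<xi>. exp (rate * real (rightmost \<xi>)))"
    using exp_rightmost_low(1)[OF \<xi>] exp_rightmost_high(1)[OF \<xi>] by linarith
  show "measure_pmf.expectation (fleming_viot p q N (time_factor * ln (real N)) \<xi>)
      (\<lambda>\<xi>. exp (rate * real (rightmost \<xi>)))
    \<le> exp (rate * real (rightmost \<xi>)) / 2 + exp (rate * growth * ln (real N))"
  proof (cases "real (rightmost \<xi>) \<le> level * ln (real N)")
    case True
    have "0 \<le> exp (rate * real (rightmost \<xi>)) / 2" by simp
    then show ?thesis using exp_rightmost_low(2)[OF \<xi> True] by linarith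
  next
    case False
    have "exp (rate * real (rightmost \<xi>) - ln (real N)) = exp (rate * real (rightmost \<xi>)) / real N"
      using N_ge by (simp add: exp_diff)
    also have "\<dots> \<le> exp (rate * real (rightmost \<xi>)) / 2"
      using N_ge by (intro divide_left_mono) auto
    finally have "exp (rate * real (rightmost \<xi>) - ln (real N)) \<le> exp (rate * real (rightmost \<xi>)) / 2" .
    moreover have "0 \<le> exp (rate * growth * ln (real N))" by simp
    ultimately show ?thesis using exp_rightmost_high(2)[OF \<xi>] False by linarith
  qed
  obtain n where n: "replicate N 1 \<in> set_pmf (kernel_power (fv_step p N) n \<xi>)"
    using kernel_power_reaches_ones[OF \<xi>] by blast
  \<comment> \<open>A Poisson law with positive mean charges every \<open>n\<close>, so the number
    of jumps needed may depend on \<open>\<xi>\<close>.\<close>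
  have "n \<in> set_pmf (poisson_pmf (real N * T))"
    using T N_ge by (simp add: set_pmf_iff)
  then have "replicate N 1 \<in> set_pmf (fleming_viot p q N T \<xi>)"
    unfolding fleming_viot_eq[OF \<xi> T] using n by auto
  then show "0 < pmf (fleming_viot p q N (time_factor * ln (real N)) \<xi>) (replicate N 1)"
    by (simp add: pmf_positive T_def)
next
  fix r
  have "{\<xi> \<in> configs N. exp (rate * real (rightmost \<xi>)) \<le> r} \<subseteq>
      {\<xi>. set \<xi> \<subseteq> {..nat \<lfloor>ln r / rate\<rfloor>} \<and> length \<xi> = N}"
  proof safe
    fix \<xi> x assume \<xi>: "\<xi> \<in> configs N" "exp (rate * real (rightmost \<xi>)) \<le> r" "x \<in> set \<xi>"
    have "x \<le> rightmost \<xi>" using \<xi> by (auto simp: rightmost_def)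
    moreover have "r > 0" using \<xi>(2) less_le_trans[OF exp_gt_zero] by blast
    then have "rate * real (rightmost \<xi>) \<le> ln r" using \<xi>(2) by (simp add: ln_ge_iff)
    then have "real (rightmost \<xi>) \<le> ln r / rate" using rate_pos by (simp add: field_simps)
    then have "rightmost \<xi> \<le> nat \<lfloor>ln r / rate\<rfloor>" by (simp add: le_nat_floor)
    ultimately show "x \<le> nat \<lfloor>ln r / rate\<rfloor>" by simp
  qed (simp add: configs_length)
  then show "finite {\<xi> \<in> configs N. exp (rate * real (rightmost \<xi>)) \<le> r}"
    by (rule finite_subset) (rule finite_lists_length_eq, simp)
next
  show "replicate N 1 \<in> configs N" by (simp add: configs_def)
qed auto

text \<open>Harris' theorem only concerns the kernel at the single time \<open>T\<close>. The
  kernels of the semigroup commute, so each of them maps a law invariant at time \<open>T\<close> to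
  another such law, and uniqueness at time \<open>T\<close> yields invariance at all times.\<close>

lemma fv_invariant_unique_exists: "\<exists>!\<mu>. fv_invariant p q N \<mu>"
proof -
  define T where "T = time_factor * ln (real N)"
  have T: "T > 0" using time_factor_pos ln_N by (simp add: T_def)
  let ?P = "fleming_viot p q N"
  interpret harris_kernel "configs N" "?P T" "\<lambda>\<xi>. exp (rate * real (rightmost \<xi>))"
    "exp (rate * growth * ln (real N))" "replicate N 1"
    unfolding T_def by (rule harris_kernel_fleming_viot)
  have add: "bind_pmf (?P s \<xi>) (?P t) = ?P (s + t) \<xi>" if "s \<ge> 0" "t \<ge> 0" "\<xi> \<in> configs N" for s t \<xi>
    using transition_function_fleming_viot[OF N_ge p_pos q_eq q_pos] that
    by (simp add: transition_function_def)
  obtain \<mu> where \<mu>: "set_pmf \<mu> \<subseteq> configs N" "bind_pmf \<mu> (?P T) = \<mu>"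
    using invariant_exists by blast
  have "bind_pmf \<mu> (?P t) = \<mu>" if t: "t \<ge> 0" for t
  proof (rule invariant_unique)
    show "set_pmf (bind_pmf \<mu> (?P t)) \<subseteq> configs N"
      using \<mu>(1) fleming_viot_configs t by fastforce
    have "bind_pmf (bind_pmf \<mu> (?P t)) (?P T) = bind_pmf \<mu> (\<lambda>\<xi>. ?P (t + T) \<xi>)"
      unfolding bind_assoc_pmf using \<mu>(1) t T by (intro bind_pmf_cong refl add) auto
    also have "\<dots> = bind_pmf (bind_pmf \<mu> (?P T)) (?P t)"
      unfolding bind_assoc_pmf add.commute[of t] using \<mu>(1) t T
      by (intro bind_pmf_cong refl add[symmetric]) auto
    finally show "bind_pmf (bind_pmf \<mu> (?P t)) (?P T) = bind_pmf \<mu> (?P t)"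
      by (simp add: \<mu>(2))
  qed (use \<mu> in auto)
  then have "fv_invariant p q N \<mu>" using \<mu>(1) unfolding fv_invariant_def by blast
  moreover have "\<nu> = \<mu>" if "fv_invariant p q N \<nu>" for \<nu>
  proof (rule invariant_unique[OF _ _ \<mu>])
    show "set_pmf \<nu> \<subseteq> configs N" "bind_pmf \<nu> (?P T) = \<nu>"
      using that less_imp_le[OF T] unfolding fv_invariant_def by blast+
  qed
  ultimately show ?thesis by blast
qed

text \<open>The factor 2 of the moment bound is written inside the exponential to fit
  \<open>expectation_exp_interpolation\<close>.\<close>

lemma exp_rightmost_invariant:
  assumes "fv_invariant p q N \<mu>"
  shows "integrable \<mu> (\<lambda>\<xi>. exp (rate * real (rightmost \<xi>)))"
    and "measure_pmf.expectation \<mu> (\<lambda>\<xi>. exp (rate * real (rightmost \<xi>)))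
      \<le> exp (ln 2 + rate * growth * ln (real N))"
proof -
  interpret harris_kernel "configs N" "fleming_viot p q N (time_factor * ln (real N))"
    "\<lambda>\<xi>. exp (rate * real (rightmost \<xi>))" "exp (rate * growth * ln (real N))" "replicate N 1"
    by (rule harris_kernel_fleming_viot)
  have "bind_pmf \<mu> (fleming_viot p q N (time_factor * ln (real N))) = \<mu>"
    using assms time_factor_pos ln_N by (simp add: fv_invariant_def)
  moreover have "set_pmf \<mu> \<subseteq> configs N" using assms by (simp add: fv_invariant_def)
  ultimately show "integrable \<mu> (\<lambda>\<xi>. exp (rate * real (rightmost \<xi>)))"
    "measure_pmf.expectation \<mu> (\<lambda>\<xi>. exp (rate * real (rightmost \<xi>)))
      \<le> exp (ln 2 + rate * growth * ln (real N))"
    using expectation_V_invariant[of \<mu>] by (simp_all add: exp_add)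
qed

end

text \<open>The constant \<open>c\<^sub>1\<close> is chosen after \<open>\<delta>\<close>, and it
  has to be: from a very high start, \<open>exp (\<delta> * max)\<close> shrinks by essentially no
  more than the factor \<open>exp (- \<delta> * (q - p) * T)\<close>. This is close to 1 when
  \<open>\<delta> * ln N\<close> is small, while the term with \<open>c\<^sub>2\<close> vanishes
  relative to the exponential as \<open>N\<close> grows.\<close>

theorem theorem1p1:
  fixes p q :: real
  assumes "p > 0" and "q > 0" and "q = 1 - p" and "q > p"
  shows "\<exists>K>0. \<exists>\<alpha>>0. \<exists>\<kappa>>0. \<exists>\<delta>\<^sub>0>0. \<exists>A>0. \<exists>c\<^sub>2>0. \<exists>c\<^sub>3>0.
    (\<forall>\<delta>::real. 0 \<le> \<delta> \<and> \<delta> < \<delta>\<^sub>0 \<longrightarrow>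
      (\<exists>c\<^sub>1>0. \<forall>N\<ge>2. \<forall>\<xi>\<in>configs N.
        let T = A * ln (real N) in
          integrable (fleming_viot p q N T \<xi>) (\<lambda>\<eta>. exp (\<delta> * real (rightmost \<eta>))) \<and>
          measure_pmf.expectation (fleming_viot p q N T \<xi>) (\<lambda>\<eta>. exp (\<delta> * real (rightmost \<eta>)))
            - exp (\<delta> * real (rightmost \<xi>))
          < - c\<^sub>1 * of_bool (real (rightmost \<xi>) > K * ln (real N)) * exp (\<delta> * real (rightmost \<xi>))
            + c\<^sub>2 * of_bool (real (rightmost \<xi>) > K * ln (real N)) * exp (- \<kappa> * T)
                * exp (\<delta> * real (rightmost \<xi>))
            + c\<^sub>3 * exp (\<delta> * \<alpha> * ln (real N)))) \<and>
    (\<forall>\<^sub>F N in sequentially. \<exists>!\<mu>. fv_invariant p q N \<mu>) \<and>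
    (\<exists>\<beta>>0. \<exists>C>0. \<forall>N\<ge>2. \<forall>\<mu>. fv_invariant p q N \<mu> \<longrightarrow>
      (\<forall>\<delta>. 0 \<le> \<delta> \<and> \<delta> < \<delta>\<^sub>0 \<longrightarrow>
        integrable \<mu> (\<lambda>\<xi>. exp (\<delta> * real (rightmost \<xi>))) \<and>
        measure_pmf.expectation \<mu> (\<lambda>\<xi>. exp (\<delta> * real (rightmost \<xi>)))
          \<le> C * exp (\<delta> * \<beta> * ln (real N))))"
proof -
  have walks: "fleming_viot_walks p q N" if "N \<ge> 2" for N
    using assms that by unfold_locales
  \<comment> \<open>The four constants depend on \<open>p\<close> and \<open>q\<close> only, so
    those of the instance \<open>N = 2\<close> are also those of every other instance.\<close>
  interpret two: fleming_viot_walks p q 2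
    by (rule walks) simp
  define \<rho> A K \<alpha> where "\<rho> = two.rate" and "A = two.time_factor" and "K = two.level" and "\<alpha> = two.growth"
  have pos: "\<rho> > 0" "A > 0" "K > 0" "\<alpha> > 0"
    using two.rate_pos two.time_factor_pos two.level_pos two.growth_pos
    by (auto simp: \<rho>_def A_def K_def \<alpha>_def)
  have scale: "\<delta> / \<rho> * (\<rho> * x) = \<delta> * x" for \<delta> x using pos by simp
  have drift: "\<exists>c\<^sub>1>0. \<forall>N\<ge>2. \<forall>\<xi>\<in>configs N.
        let T = A * ln (real N) in
          integrable (fleming_viot p q N T \<xi>) (\<lambda>\<eta>. exp (\<delta> * real (rightmost \<eta>))) \<and>
          measure_pmf.expectation (fleming_viot p q N T \<xi>) (\<lambda>\<eta>. exp (\<delta> * real (rightmost \<eta>)))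
            - exp (\<delta> * real (rightmost \<xi>))
          < - c\<^sub>1 * of_bool (real (rightmost \<xi>) > K * ln (real N)) * exp (\<delta> * real (rightmost \<xi>))
            + 1 * of_bool (real (rightmost \<xi>) > K * ln (real N)) * exp (- 1 * T)
                * exp (\<delta> * real (rightmost \<xi>))
            + 2 * exp (\<delta> * \<alpha> * ln (real N))"
    if \<delta>: "0 \<le> \<delta>" "\<delta> < \<rho>" for \<delta>
  proof -
    define \<theta> where "\<theta> = \<delta> / \<rho>"
    have \<theta>: "0 \<le> \<theta>" "\<theta> \<le> 1" using \<delta> pos by (auto simp: \<theta>_def)
    have \<theta>\<rho>: "\<theta> * (\<rho> * x) = \<delta> * x" for x by (simp only: \<theta>_def scale)
    \<comment> \<open>Interpolation turns the gain \<open>1 / N\<close> into \<open>N\<close> to the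
      power \<open>- \<theta>\<close>, and \<open>N \<ge> 2\<close> bounds this by
      \<open>exp (- (\<theta> * ln 2))\<close>. At \<open>\<delta> = 0\<close> this would give
      \<open>c\<^sub>1 = 0\<close>, so a separate positive value is taken.\<close>
    define c\<^sub>1 where "c\<^sub>1 = (if \<delta> = 0 then 1 else 1 - exp (- (\<theta> * ln 2)))"
    have "c\<^sub>1 > 0" using \<delta> pos by (simp add: c\<^sub>1_def \<theta>_def)
    show ?thesis
    proof (intro exI[of _ c\<^sub>1] conjI allI ballI impI \<open>c\<^sub>1 > 0\<close>)
      fix N :: nat and \<xi> assume N: "2 \<le> N" and \<xi>: "\<xi> \<in> configs N"
      interpret fleming_viot_walks p q N by (rule walks[OF N])
      define L M where "L = ln (real N)" and "M = fleming_viot p q N (A * L) \<xi>"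
      define m where "m = real (rightmost \<xi>)"
      let ?E = "measure_pmf.expectation M (\<lambda>\<eta>. exp (\<delta> * real (rightmost \<eta>)))"
      have L: "L \<ge> ln 2" "L > 0" using ln_N by (simp_all add: L_def)
      have one: "1 \<le> exp (\<delta> * \<alpha> * L)" using \<delta> pos L by simp
      have "integrable M (\<lambda>\<eta>. exp (\<delta> * real (rightmost \<eta>))) \<and> ?E - exp (\<delta> * m)
          < - c\<^sub>1 * of_bool (m > K * L) * exp (\<delta> * m)
            + 1 * of_bool (m > K * L) * exp (- 1 * (A * L)) * exp (\<delta> * m) + 2 * exp (\<delta> * \<alpha> * L)"
      proof (cases "m > K * L")
        case True
        note high = exp_rightmost_high[OF \<xi>, folded \<rho>_def A_def K_def L_def m_def, OF True]
        note ineq = expectation_exp_interpolation[OF high \<theta>, folded M_def, unfolded \<theta>\<rho>]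
        \<comment> \<open>The 2 is the \<open>c\<^sub>3\<close> term bounded below through
          \<open>one\<close>. It makes the inequality strict, and for \<open>\<delta> = 0\<close> it
          leaves \<open>0 < - 1 + 2\<close>.\<close>
        have "?E - exp (\<delta> * m) < - c\<^sub>1 * exp (\<delta> * m) + 2"
        proof (cases "\<delta> = 0")
          case True
          then show ?thesis by (simp add: c\<^sub>1_def)
        next
          case False
          have "?E \<le> exp (\<theta> * (\<rho> * m - L))" by (rule ineq(2))
          also have "\<theta> * (\<rho> * m - L) = \<delta> * m - \<theta> * L"
            by (simp only: right_diff_distrib \<theta>\<rho>)
          also have "exp (\<delta> * m - \<theta> * L) \<le> exp (\<delta> * m - \<theta> * ln 2)"
            using L \<theta> by (simp add: mult_left_mono)
          also have "\<dots> = exp (\<delta> * m) * (1 - c\<^sub>1)"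
            using False by (simp add: c\<^sub>1_def flip: exp_add)
          finally show ?thesis by (simp add: algebra_simps)
        qed
        moreover have "0 \<le> exp (- 1 * (A * L)) * exp (\<delta> * m)" by simp
        ultimately have "?E - exp (\<delta> * m) < - c\<^sub>1 * exp (\<delta> * m) + exp (- 1 * (A * L)) * exp (\<delta> * m)
            + 2 * exp (\<delta> * \<alpha> * L)" using one by linarith
        then show ?thesis using True ineq(1) by simp
      next
        case False
        then have "m \<le> K * L" by simp
        note low = exp_rightmost_low[OF \<xi>, folded \<rho>_def A_def K_def \<alpha>_def L_def m_def, OF this]
        note ineq = expectation_exp_interpolation[OF low \<theta>, folded M_def, unfolded mult.assoc[of \<rho>] \<theta>\<rho>]
        have "0 < exp (\<delta> * m)" "0 < exp (\<delta> * \<alpha> * L)" by simp_all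
        then have "?E - exp (\<delta> * m) < 2 * exp (\<delta> * \<alpha> * L)"
          using ineq(2) by (simp only: mult.assoc)
        then show ?thesis using False ineq(1) by simp
      qed
      then show "let T = A * ln (real N) in
          integrable (fleming_viot p q N T \<xi>) (\<lambda>\<eta>. exp (\<delta> * real (rightmost \<eta>))) \<and>
          measure_pmf.expectation (fleming_viot p q N T \<xi>) (\<lambda>\<eta>. exp (\<delta> * real (rightmost \<eta>)))
            - exp (\<delta> * real (rightmost \<xi>))
          < - c\<^sub>1 * of_bool (real (rightmost \<xi>) > K * ln (real N)) * exp (\<delta> * real (rightmost \<xi>))
            + 1 * of_bool (real (rightmost \<xi>) > K * ln (real N)) * exp (- 1 * T)
                * exp (\<delta> * real (rightmost \<xi>))
            + 2 * exp (\<delta> * \<alpha> * ln (real N))"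
        unfolding Let_def L_def M_def m_def .
    qed
  qed
  have ergodic: "\<forall>\<^sub>F N in sequentially. \<exists>!\<mu>. fv_invariant p q N \<mu>"
    unfolding eventually_sequentially using fleming_viot_walks.fv_invariant_unique_exists[OF walks] by blast
  have moments: "integrable \<mu> (\<lambda>\<xi>. exp (\<delta> * real (rightmost \<xi>))) \<and>
        measure_pmf.expectation \<mu> (\<lambda>\<xi>. exp (\<delta> * real (rightmost \<xi>)))
          \<le> 2 * exp (\<delta> * \<alpha> * ln (real N))"
    if N: "2 \<le> N" and \<mu>: "fv_invariant p q N \<mu>" and \<delta>: "0 \<le> \<delta>" "\<delta> < \<rho>" for N \<mu> \<delta>
  proof -
    interpret fleming_viot_walks p q N by (rule walks[OF N])
    have \<theta>: "0 \<le> \<delta> / \<rho>" "\<delta> / \<rho> \<le> 1" using \<delta> pos by auto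
    note ineq = expectation_exp_interpolation[OF exp_rightmost_invariant[OF \<mu>, folded \<rho>_def \<alpha>_def] \<theta>,
        unfolded mult.assoc[of \<rho>] distrib_left scale]
    have "exp (\<delta> / \<rho> * ln 2 + \<delta> * (\<alpha> * ln (real N))) \<le> exp (1 * ln 2 + \<delta> * (\<alpha> * ln (real N)))"
      unfolding exp_le_cancel_iff using \<theta> by (intro add_right_mono mult_right_mono) auto
    also have "\<dots> = 2 * exp (\<delta> * \<alpha> * ln (real N))"
      by (simp add: exp_add mult.assoc)
    finally show ?thesis using ineq by auto
  qed
  have moments_ex: "\<exists>\<beta>>0. \<exists>C>0. \<forall>N\<ge>2. \<forall>\<mu>. fv_invariant p q N \<mu> \<longrightarrow>
      (\<forall>\<delta>. 0 \<le> \<delta> \<and> \<delta> < \<rho> \<longrightarrow>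
        integrable \<mu> (\<lambda>\<xi>. exp (\<delta> * real (rightmost \<xi>))) \<and>
        measure_pmf.expectation \<mu> (\<lambda>\<xi>. exp (\<delta> * real (rightmost \<xi>)))
          \<le> C * exp (\<delta> * \<beta> * ln (real N)))"
    by (rule exI[of _ \<alpha>], rule conjI[OF pos(4)], rule exI[of _ 2], rule conjI[OF zero_less_numeral],
        intro allI impI, elim conjE, rule moments)
  show ?thesis
    by (rule exI[of _ K], rule conjI[OF pos(3)], rule exI[of _ \<alpha>], rule conjI[OF pos(4)],
        rule exI[of _ 1], rule conjI[OF zero_less_one], rule exI[of _ \<rho>], rule conjI[OF pos(1)],
        rule exI[of _ A], rule conjI[OF pos(2)], rule exI[of _ 1], rule conjI[OF zero_less_one],
        rule exI[of _ 2], rule conjI[OF zero_less_numeral], intro conjI ergodic moments_ex allI impI,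
        elim conjE, rule drift)
qed

end
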